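(* Let $(X,\mathcal F)$ be a compact Polish foliated space, and let $L$ be a non-compact leaf. Then $L$ is Higson recurrent if and only if $\mathcal F$ is minimal.
   Context: Foliated spaces. A (topological) foliated structure $\mathcal F$ of dimension $n$ on a space $X$ is given by an atlas $\{(U_i,\phi_i)\}$, where $\{U_i\}$ is an open cover of $X$ and $\phi_i:U_i\to B_i\times Z_i$ are homeomorphisms, with $B_i\subset\mathbb R^n$ an open ball and $Z_i$ a locally compact Polish space, whose changes of coordinates are locally of the form $\phi_j\phi_i^{-1}(x,z)=(x_{ij}(x,z),h_{ij}(z))$. The sets $\phi_i^{-1}(B_i\times\{z\})$ are the plaques; the leaves are the connected components of $X$ with the (leaf) topology whose basic open sets are the plaques of all foliated charts. $(X,\mathcal F)$ is a compact Polish foliated space if $X$ is compact, Hausdorff and second countable. $\mathcal F$ is minimal if every leaf is dense in $X$. Leaf metrics. A foliated atlas $\mathcal U=\{(U_i,\phi_i)\}$ is regular if: each $(U_i,\phi_i)$ is the restriction of a foliated chart $(\widetilde U_i,\tilde\phi_i)$ with $\overline{U_i}\subset\widetilde U_i$; $\{U_i\}$ is locally finite; and the closure of every plaque of $(U_i,\phi_i)$ meets at most the closure of one plaque of $(U_j,\phi_j)$, for all $i,j$. Fix a regular foliated atlas $\mathcal U$. For $x,y$ in the same leaf, $d^*_{\mathcal U}(x,y)=0$ if $x=y$, and otherwise it is the minimum number of $\mathcal U$-plaques whose union is connected and contains $x$ and $y$. Higson compactification. Let $L$ be a leaf with the leaf topology. A function on $L$ vanishes at infinity if for every $\epsilon>0$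 its absolute value is $<\epsilon$ outside some compact subset of $L$. For $f:L\to\mathbb C$ and $R>0$, $\mathsf V_Rf(x)=\sup\{|f(x)-f(y)|\mid y\in L,\ d^*_{\mathcal U}(x,y)<R\}$. A bounded function $f$ is a Higson function if $\mathsf V_Rf$ vanishes at infinity for all $R>0$. The Higson compactification $L^\nu$ is the compactification of $L$ corresponding (by Gelfand duality) to the unital closed involutive algebra of bounded Higson functions on $L$ that are continuous for the leaf topology; i.e., $L^\nu$ is a compact Hausdorff space containing $L$ as a dense open subspace, and these are exactly the functions on $L$ with a continuous extension to $L^\nu$. It is independent of $\mathcal U$. The Higson corona is $\nu L=L^\nu\setminus L$. Higson recurrence. For $\mathbf e\in\nu L$, $\lim_{\mathbf e}L=\bigcap_V\mathrm{Cl}_X(V\cap L)$, where $V$ runs in the collection of neighborhoods of $\mathbf e$ in $L^\nu$. The leaf $L$ is Higson recurrent if $\lim_{\mathbf e}L=X$ for all $\mathbf e\in\nu L$. *)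

theory Defs
  imports "HOL-Analysis.Analysis"
begin

section \<open>Foliated spaces\<close>

text \<open>
  A chart \<open>\<phi> : U \<rightarrow> B \<times> Z\<close>. The dimension of the foliated structure is the size of the
  index type \<open>'n\<close>. The transversals of different charts are arbitrary topologies
  (with arbitrary underlying sets) on the common type \<open>'z\<close>.
\<close>

record ('a, 'n, 'z) chart =
  chart_dom :: "'a set"
  chart_map :: "'a \<Rightarrow> (real ^ 'n) \<times> 'z"
  chart_ball :: "(real ^ 'n) set"
  chart_trans :: "'z topology"

definition is_chart :: "'a topology \<Rightarrow> ('a, 'n::finite, 'z) chart \<Rightarrow> bool" where
  "is_chart X c \<longleftrightarrow>
     openin X (chart_dom c) \<and>
     (\<exists>a r. 0 < r \<and> chart_ball c = ball a r) \<and>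
     locally_compact_space (chart_trans c) \<and>
     completely_metrizable_space (chart_trans c) \<and>
     second_countable (chart_trans c) \<and>
     homeomorphic_map (subtopology X (chart_dom c))
       (prod_topology (top_of_set (chart_ball c)) (chart_trans c)) (chart_map c)"

text \<open>The change of coordinates from \<open>c\<close> to \<open>d\<close> is locally of the form
  \<open>(x, z) \<mapsto> (\<xi> (x, z), h z)\<close>.\<close>

definition foliated_change ::
    "'a topology \<Rightarrow> ('a, 'n::finite, 'z) chart \<Rightarrow> ('a, 'n, 'z) chart \<Rightarrow> bool" where
  "foliated_change X c d \<longleftrightarrow>
     (\<forall>p \<in> chart_dom c \<inter> chart_dom d.
        \<exists>W. openin X W \<and> p \<in> W \<and> W \<subseteq> chart_dom c \<inter> chart_dom d \<and>
          (\<exists>\<xi> h. \<forall>q\<in>W. chart_map d q = (\<xi> (chart_map c q), h (snd (chart_map c q)))))"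

definition foliated_atlas :: "'a topology \<Rightarrow> ('a, 'n::finite, 'z) chart set \<Rightarrow> bool" where
  "foliated_atlas X \<A> \<longleftrightarrow>
     (\<forall>c\<in>\<A>. is_chart X c) \<and>
     \<Union> (chart_dom ` \<A>) = topspace X \<and>
     (\<forall>c\<in>\<A>. \<forall>d\<in>\<A>. foliated_change X c d)"

text \<open>The foliated structure \<open>\<F>\<close> is given by a foliated atlas \<open>\<A>\<close>. Its foliated charts are all
  the charts compatible with \<open>\<A>\<close>, that is, the members of the maximal atlas containing \<open>\<A>\<close>.\<close>

definition foliated_chart ::
    "'a topology \<Rightarrow> ('a, 'n::finite, 'z) chart set \<Rightarrow> ('a, 'n, 'z) chart \<Rightarrow> bool" where
  "foliated_chart X \<A> c \<longleftrightarrow>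
     is_chart X c \<and> (\<forall>d\<in>\<A>. foliated_change X c d \<and> foliated_change X d c)"

definition plaques :: "('a, 'n::finite, 'z) chart \<Rightarrow> 'a set set" where
  "plaques c = {chart_dom c \<inter> chart_map c -` (chart_ball c \<times> {z}) | z. z \<in> topspace (chart_trans c)}"

text \<open>The plaques of all foliated charts form a base, so the topology
  they generate as a subbase is the one having them as basic open sets.\<close>

definition leaf_topology :: "'a topology \<Rightarrow> ('a, 'n::finite, 'z) chart set \<Rightarrow> 'a topology" where
  "leaf_topology X \<A> = topology_generated_by (\<Union> (plaques ` {c. foliated_chart X \<A> c}))"

definition leaves :: "'a topology \<Rightarrow> ('a, 'n::finite, 'z) chart set \<Rightarrow> 'a set set" where
  "leaves X \<A> = connected_components_of (leaf_topology X \<A>)"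

definition compact_polish_foliated_space ::
    "'a topology \<Rightarrow> ('a, 'n::finite, 'z) chart set \<Rightarrow> bool" where
  "compact_polish_foliated_space X \<A> \<longleftrightarrow>
     compact_space X \<and> Hausdorff_space X \<and> second_countable X \<and> foliated_atlas X \<A>"

definition minimal_foliation :: "'a topology \<Rightarrow> ('a, 'n::finite, 'z) chart set \<Rightarrow> bool" where
  "minimal_foliation X \<A> \<longleftrightarrow> (\<forall>M \<in> leaves X \<A>. X closure_of M = topspace X)"


section \<open>Regular atlases and leaf metrics\<close>

definition chart_restriction ::
    "('a, 'n::finite, 'z) chart \<Rightarrow> ('a, 'n, 'z) chart \<Rightarrow> bool" where
  "chart_restriction c c' \<longleftrightarrow>
     chart_dom c \<subseteq> chart_dom c' \<and> (\<forall>p \<in> chart_dom c. chart_map c p = chart_map c' p)"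

text \<open>\<open>\<U>\<close> is a regular foliated atlas of the foliated structure given by \<open>\<A>\<close>.
  Local finiteness is that of the family of domains, not just of the set of domains.\<close>

definition regular_foliated_atlas ::
    "'a topology \<Rightarrow> ('a, 'n::finite, 'z) chart set \<Rightarrow> ('a, 'n, 'z) chart set \<Rightarrow> bool" where
  "regular_foliated_atlas X \<A> \<U> \<longleftrightarrow>
     foliated_atlas X \<U> \<and>
     (\<forall>c\<in>\<U>. foliated_chart X \<A> c) \<and>
     (\<forall>c\<in>\<U>. \<exists>c'. foliated_chart X \<A> c' \<and> chart_restriction c c' \<and>
        X closure_of chart_dom c \<subseteq> chart_dom c') \<and>
     (\<forall>p \<in> topspace X. \<exists>W. openin X W \<and> p \<in> W \<and> finite {c\<in>\<U>. chart_dom c \<inter> W \<noteq> {}}) \<and>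
     (\<forall>c\<in>\<U>. \<forall>d\<in>\<U>. \<forall>P \<in> plaques c. \<forall>Q \<in> plaques d. \<forall>Q' \<in> plaques d.
        X closure_of P \<inter> X closure_of Q \<noteq> {} \<and> X closure_of P \<inter> X closure_of Q' \<noteq> {}
          \<longrightarrow> Q = Q')"

text \<open>The metric \<open>d\<^sup>*\<close>, meaningful for \<open>x\<close>, \<open>y\<close> in the same leaf; connectedness is that of
  the leaf topology.\<close>

definition plaque_dist ::
    "'a topology \<Rightarrow> ('a, 'n::finite, 'z) chart set \<Rightarrow> ('a, 'n, 'z) chart set \<Rightarrow> 'a \<Rightarrow> 'a \<Rightarrow> nat" where
  "plaque_dist X \<A> \<U> x y =
     (if x = y then 0
      else LEAST k. \<exists>\<P>. \<P> \<subseteq> \<Union> (plaques ` \<U>) \<and> finite \<P> \<and> card \<P> = k \<and>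
             connectedin (leaf_topology X \<A>) (\<Union>\<P>) \<and> x \<in> \<Union>\<P> \<and> y \<in> \<Union>\<P>)"


section \<open>Higson compactification\<close>

text \<open>Here \<open>T\<close> is a topological space (a leaf with its leaf topology) and \<open>d\<close> is an integer-valued
  metric on its points.\<close>

definition vanishes_at_infinity :: "'a topology \<Rightarrow> ('a \<Rightarrow> real) \<Rightarrow> bool" where
  "vanishes_at_infinity T g \<longleftrightarrow>
     (\<forall>\<epsilon>>0. \<exists>K. compactin T K \<and> (\<forall>x \<in> topspace T - K. \<bar>g x\<bar> < \<epsilon>))"

definition variation ::
    "'a topology \<Rightarrow> ('a \<Rightarrow> 'a \<Rightarrow> nat) \<Rightarrow> real \<Rightarrow> ('a \<Rightarrow> complex) \<Rightarrow> 'a \<Rightarrow> real" where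
  "variation T d R f x = (SUP y \<in> {y \<in> topspace T. real (d x y) < R}. cmod (f x - f y))"

definition higson_function :: "'a topology \<Rightarrow> ('a \<Rightarrow> 'a \<Rightarrow> nat) \<Rightarrow> ('a \<Rightarrow> complex) \<Rightarrow> bool" where
  "higson_function T d f \<longleftrightarrow>
     bounded (f ` topspace T) \<and> (\<forall>R>0. vanishes_at_infinity T (variation T d R f))"

text \<open>The algebra of continuous bounded Higson functions; its elements are
  extensional, so that each function on the space is represented exactly once.\<close>

definition higson_algebra :: "'a topology \<Rightarrow> ('a \<Rightarrow> 'a \<Rightarrow> nat) \<Rightarrow> ('a \<Rightarrow> complex) set" where
  "higson_algebra T d =
     {f \<in> extensional (topspace T). continuous_map T euclidean f \<and> higson_function T d f}"

text \<open>Characters: unital involutive algebra homomorphisms from the Higson algebra to \<open>\<complex>\<close>.\<close>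

definition higson_characters ::
    "'a topology \<Rightarrow> ('a \<Rightarrow> 'a \<Rightarrow> nat) \<Rightarrow> (('a \<Rightarrow> complex) \<Rightarrow> complex) set" where
  "higson_characters T d =
     {\<omega> \<in> extensional (higson_algebra T d).
        \<omega> (\<lambda>x\<in>topspace T. 1) = 1 \<and>
        (\<forall>f \<in> higson_algebra T d. \<forall>g \<in> higson_algebra T d.
           \<omega> (\<lambda>x\<in>topspace T. f x + g x) = \<omega> f + \<omega> g \<and>
           \<omega> (\<lambda>x\<in>topspace T. f x * g x) = \<omega> f * \<omega> g) \<and>
        (\<forall>f \<in> higson_algebra T d.
           (\<forall>a. \<omega> (\<lambda>x\<in>topspace T. a * f x) = a * \<omega> f) \<and>
           \<omega> (\<lambda>x\<in>topspace T. cnj (f x)) = cnj (\<omega> f))}"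

text \<open>The compactification corresponding to the Higson algebra by Gelfand duality is the
  space of characters with the topology of pointwise convergence.\<close>

definition higson_compactification ::
    "'a topology \<Rightarrow> ('a \<Rightarrow> 'a \<Rightarrow> nat) \<Rightarrow> (('a \<Rightarrow> complex) \<Rightarrow> complex) topology" where
  "higson_compactification T d =
     subtopology (product_topology (\<lambda>_. euclidean) (higson_algebra T d)) (higson_characters T d)"

text \<open>A point of the space is identified with the evaluation at that point.\<close>

definition higson_embedding ::
    "'a topology \<Rightarrow> ('a \<Rightarrow> 'a \<Rightarrow> nat) \<Rightarrow> 'a \<Rightarrow> (('a \<Rightarrow> complex) \<Rightarrow> complex)" where
  "higson_embedding T d x = (\<lambda>f \<in> higson_algebra T d. f x)"

definition higson_corona ::
    "'a topology \<Rightarrow> ('a \<Rightarrow> 'a \<Rightarrow> nat) \<Rightarrow> (('a \<Rightarrow> complex) \<Rightarrow> complex) set" where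
  "higson_corona T d =
     topspace (higson_compactification T d) - higson_embedding T d ` topspace T"


section \<open>Higson recurrence\<close>

definition leaf_space :: "'a topology \<Rightarrow> ('a, 'n::finite, 'z) chart set \<Rightarrow> 'a set \<Rightarrow> 'a topology" where
  "leaf_space X \<A> L = subtopology (leaf_topology X \<A>) L"

text \<open>\<open>V\<close> runs over the (not necessarily open) neighborhoods of \<open>e\<close> in the Higson compactification.\<close>

definition higson_limit_set ::
    "'a topology \<Rightarrow> ('a, 'n::finite, 'z) chart set \<Rightarrow> ('a, 'n, 'z) chart set \<Rightarrow> 'a set \<Rightarrow>
     (('a \<Rightarrow> complex) \<Rightarrow> complex) \<Rightarrow> 'a set" where
  "higson_limit_set X \<A> \<U> L e =
     (let T = leaf_space X \<A> L; d = plaque_dist X \<A> \<U>; C = higson_compactification T d in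
      \<Inter> {X closure_of {x \<in> L. higson_embedding T d x \<in> V} | V.
           V \<subseteq> topspace C \<and> (\<exists>W. openin C W \<and> e \<in> W \<and> W \<subseteq> V)})"

definition higson_recurrent ::
    "'a topology \<Rightarrow> ('a, 'n::finite, 'z) chart set \<Rightarrow> ('a, 'n, 'z) chart set \<Rightarrow> 'a set \<Rightarrow> bool" where
  "higson_recurrent X \<A> \<U> L \<longleftrightarrow>
     (\<forall>e \<in> higson_corona (leaf_space X \<A> L) (plaque_dist X \<A> \<U>).
        higson_limit_set X \<A> \<U> L e = topspace X)"

end

theory Submission
  imports Defs
begin

text \<open>
  On a leaf \<open>L\<close> the distance is the length of a shortest chain of intersecting plaques, and its
  balls are relatively compact. Given an open set \<open>W\<close>, the points of \<open>X\<close> joined to \<open>W\<close>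
  by a chain of length \<open>k\<close> form an open set.

  If the foliation is minimal, these sets increase to the compact space \<open>X\<close>, so \<open>L \<inter> W\<close> is a
  net in \<open>L\<close>. If a basic neighbourhood of a corona point \<open>e\<close>, given by \<open>f\<^sub>1, \<dots>, f\<^sub>m\<close>, missed the net,
  the Higson function \<open>\<Sum>\<^sub>i \<bar>f\<^sub>i - e f\<^sub>i\<bar>\<^sup>2\<close>, which is in the kernel of \<open>e\<close>, would be bounded
  away from zero on the net, hence by slow oscillation outside a compact set, which forces \<open>e\<close> to be
  an evaluation.

  If some leaf is not dense, then for some nonempty open \<open>W\<close> there are points of \<open>L\<close> tending to
  infinity and centres of balls disjoint from \<open>W\<close> of radii tending to infinity: this is clear if \<open>L\<close> is
  not dense, and otherwise one takes points of \<open>L\<close> close to the given leaf. A continuous Higson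
  function which tends to 1 at the centres and vanishes off the balls shows that a limit in the
  corona of the centres does not have the points of \<open>W\<close> in its limit set.
\<close>

section \<open>Higson functions and characters\<close>

text \<open>Corona points are given as characters, so both directions argue with single Higson
  functions. A member of the algebra bounded away from zero is a unit and cannot lie in the kernel
  of a character. Squared moduli are summed because a sum of nonnegative functions is small only
  where every summand is; this merges the finitely many conditions of a basic neighbourhood into
  one. In the converse direction the obstacle is that \<open>plaque_dist\<close> takes integer
  values: functions of the distance can oscillate slowly, but they need not be continuous for the
  leaf topology. The functions are therefore first built without continuity and then averaged over
  plaques, with weights continuous on \<open>X\<close>. The average looks one unit further in the
  distance, which is the origin of most shifts by one. The radii of the balls must tend to infinity
  because a tent of height 1 has the inverse of its radius as slope.\<close>

locale dist_space =
  fixes T :: "'a topology" and d :: "'a \<Rightarrow> 'a \<Rightarrow> nat"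
  assumes dist_refl: "d x x = 0"
begin

text \<open>Working form of the definition: the supremum becomes a pointwise estimate and the real
  radius a natural one. The closed radius \<open>R\<close> is covered by the open radius
  \<open>R + 1\<close>, and a real radius by its ceiling. A supremum of values below
  \<open>\<epsilon> / 2\<close> is still strictly below \<open>\<epsilon>\<close>.\<close>

lemma higson_function_iff:
  "higson_function T d f \<longleftrightarrow> bounded (f ` topspace T) \<and>
     (\<forall>(R::nat) \<epsilon>. 0 < \<epsilon> \<longrightarrow> (\<exists>K. compactin T K \<and>
        (\<forall>x\<in>topspace T - K. \<forall>y\<in>topspace T. d x y \<le> R \<longrightarrow> cmod (f x - f y) < \<epsilon>)))"
    (is "_ \<longleftrightarrow> ?b \<and> ?s")
proof -
  have bdd: "bdd_above ((\<lambda>y. cmod (f x - f y)) ` {y \<in> topspace T. real (d x y) < R})"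
    if b: ?b and x: "x \<in> topspace T" for x R
  proof -
    from b obtain B where B: "\<And>y. y \<in> topspace T \<Longrightarrow> cmod (f y) \<le> B"
      by (auto simp: bounded_iff)
    have "cmod (f x - f y) \<le> B + B" if "y \<in> topspace T" for y
      by (metis B add_mono norm_triangle_ineq4 order_trans that x)
    then show ?thesis by (intro bdd_aboveI2[where M = "B + B"]) auto
  qed
  show ?thesis
  proof (intro iffI conjI allI impI)
    assume h: "higson_function T d f"
    then show b: ?b by (simp add: higson_function_def)
    fix R :: nat and \<epsilon> :: real
    assume "0 < \<epsilon>"
    moreover have "vanishes_at_infinity T (variation T d (real R + 1) f)"
      using h by (simp add: higson_function_def)
    ultimately obtain K where K: "compactin T K"
      "\<And>x. x \<in> topspace T - K \<Longrightarrow> \<bar>variation T d (real R + 1) f x\<bar> < \<epsilon>"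
      by (meson vanishes_at_infinity_def)
    have "cmod (f x - f y) < \<epsilon>" if "x \<in> topspace T - K" "y \<in> topspace T" "d x y \<le> R" for x y
    proof -
      have "cmod (f x - f y) \<le> variation T d (real R + 1) f x"
        unfolding variation_def using that bdd[OF b] by (intro cSUP_upper) auto
      also have "\<dots> < \<epsilon>" using K(2)[OF that(1)] by simp
      finally show ?thesis .
    qed
    with K(1) show "\<exists>K. compactin T K \<and>
        (\<forall>x\<in>topspace T - K. \<forall>y\<in>topspace T. d x y \<le> R \<longrightarrow> cmod (f x - f y) < \<epsilon>)" by blast
  next
    assume bs: "?b \<and> ?s"
    have "vanishes_at_infinity T (variation T d R f)" if "0 < R" for R
      unfolding vanishes_at_infinity_def
    proof (intro allI impI)
      fix \<epsilon> :: real
      assume "0 < \<epsilon>"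
      then obtain K where K: "compactin T K"
        "\<And>x y. x \<in> topspace T - K \<Longrightarrow> y \<in> topspace T \<Longrightarrow> d x y \<le> nat \<lceil>R\<rceil> \<Longrightarrow> cmod (f x - f y) < \<epsilon> / 2"
        using bs by (metis half_gt_zero)
      have "\<bar>variation T d R f x\<bar> < \<epsilon>" if x: "x \<in> topspace T - K" for x
      proof -
        \<comment> \<open>Reflexivity puts \<open>x\<close> itself into the index set, so the
          supremum is over a nonempty set and is nonnegative.\<close>
        have mem: "x \<in> {y \<in> topspace T. real (d x y) < R}" using x \<open>0 < R\<close> dist_refl by auto
        have "0 \<le> variation T d R f x"
          unfolding variation_def
          using bs x by (intro cSUP_upper2[OF bdd mem]) auto
        moreover have "variation T d R f x \<le> \<epsilon> / 2"
          unfolding variation_def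
        proof (rule cSUP_least)
          show "{y \<in> topspace T. real (d x y) < R} \<noteq> {}" using mem by blast
          fix y assume "y \<in> {y \<in> topspace T. real (d x y) < R}"
          then have "y \<in> topspace T" "d x y \<le> nat \<lceil>R\<rceil>" by (auto, linarith)
          then show "cmod (f x - f y) \<le> \<epsilon> / 2" using K(2)[OF x] by force
        qed
        ultimately show ?thesis using \<open>0 < \<epsilon>\<close> by linarith
      qed
      with K(1) show "\<exists>K. compactin T K \<and> (\<forall>x\<in>topspace T - K. \<bar>variation T d R f x\<bar> < \<epsilon>)" by blast
    qed
    with bs show "higson_function T d f" by (simp add: higson_function_def)
  qed
qed

section \<open>Closure of the Higson algebra under algebraic operations\<close>

lemma higson_algebra_bounded:
  assumes "f \<in> higson_algebra T d"
  obtains B where "\<And>x. x \<in> topspace T \<Longrightarrow> cmod (f x) \<le> B"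
  using assms by (auto simp: higson_algebra_def higson_function_def bounded_iff)

lemma higson_algebra_continuous:
  "f \<in> higson_algebra T d \<Longrightarrow> continuous_map T euclidean f"
  by (simp add: higson_algebra_def)

lemma higson_algebra_slow:
  assumes "f \<in> higson_algebra T d" "0 < \<epsilon>"
  obtains K where "compactin T K"
    "\<And>x y. x \<in> topspace T - K \<Longrightarrow> y \<in> topspace T \<Longrightarrow> d x y \<le> R \<Longrightarrow> cmod (f x - f y) < \<epsilon>"
proof -
  have "higson_function T d f" using assms(1) by (simp add: higson_algebra_def)
  then obtain K where "compactin T K"
    "\<forall>x\<in>topspace T - K. \<forall>y\<in>topspace T. d x y \<le> R \<longrightarrow> cmod (f x - f y) < \<epsilon>"
    using assms(2) unfolding higson_function_iff by blast
  then show thesis using that by blast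
qed

lemma higson_algebraI:
  assumes "continuous_map T euclidean h"
    and "\<And>x. x \<in> topspace T \<Longrightarrow> cmod (h x) \<le> B"
    and "\<And>R \<epsilon>. 0 < \<epsilon> \<Longrightarrow> \<exists>K. compactin T K \<and>
        (\<forall>x\<in>topspace T - K. \<forall>y\<in>topspace T. d x y \<le> R \<longrightarrow> cmod (h x - h y) < \<epsilon>)"
  shows "(\<lambda>x\<in>topspace T. h x) \<in> higson_algebra T d"
proof -
  have "bounded (restrict h (topspace T) ` topspace T)"
    using assms(2) by (auto simp: bounded_iff)
  moreover have "continuous_map T euclidean (restrict h (topspace T))"
    using assms(1) by (rule continuous_map_eq) simp
  ultimately show ?thesis
    using assms(3) by (simp add: higson_algebra_def higson_function_iff)
qed

text \<open>Common source of the closure properties below: increments dominated by those of slowly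
  oscillating functions are eventually small too. Two members are allowed for the sake of sums and
  products; unary operations take the same one twice.\<close>

lemma higson_algebra_lipschitz:
  assumes f: "f \<in> higson_algebra T d" and g: "g \<in> higson_algebra T d"
    and h: "continuous_map T euclidean h" "\<And>x. x \<in> topspace T \<Longrightarrow> cmod (h x) \<le> B"
    and lip: "\<And>x y. x \<in> topspace T \<Longrightarrow> y \<in> topspace T \<Longrightarrow>
        cmod (h x - h y) \<le> C * (cmod (f x - f y) + cmod (g x - g y))"
  shows "(\<lambda>x\<in>topspace T. h x) \<in> higson_algebra T d"
proof (rule higson_algebraI[OF h])
  fix R and \<epsilon> :: real
  assume "0 < \<epsilon>"
  \<comment> \<open>Positive whatever the sign of \<open>C\<close>, and \<open>C' / 2\<close>
    dominates \<open>C\<close>, so each of the two increments contributes at most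
    \<open>\<epsilon> / 2\<close>.\<close>
  define C' where "C' = 2 * (\<bar>C\<bar> + 1)"
  have "C' > 0" "C \<le> C' / 2" by (auto simp: C'_def)
  with \<open>0 < \<epsilon>\<close> have pos: "0 < \<epsilon> / C'" by simp
  obtain K1 where K1: "compactin T K1"
    "\<And>x y. x \<in> topspace T - K1 \<Longrightarrow> y \<in> topspace T \<Longrightarrow> d x y \<le> R \<Longrightarrow> cmod (f x - f y) < \<epsilon> / C'"
    using higson_algebra_slow[OF f pos] by blast
  obtain K2 where K2: "compactin T K2"
    "\<And>x y. x \<in> topspace T - K2 \<Longrightarrow> y \<in> topspace T \<Longrightarrow> d x y \<le> R \<Longrightarrow> cmod (g x - g y) < \<epsilon> / C'"
    using higson_algebra_slow[OF g pos] by blast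
  have "cmod (h x - h y) < \<epsilon>"
    if "x \<in> topspace T - (K1 \<union> K2)" "y \<in> topspace T" "d x y \<le> R" for x y
  proof -
    have "cmod (h x - h y) \<le> C * (cmod (f x - f y) + cmod (g x - g y))"
      using lip that by blast
    also have "\<dots> \<le> C' / 2 * (cmod (f x - f y) + cmod (g x - g y))"
      using \<open>C \<le> C' / 2\<close> by (intro mult_right_mono) auto
    also have "\<dots> < C' / 2 * (\<epsilon> / C' + \<epsilon> / C')"
      using \<open>C' > 0\<close> K1(2)[of x y] K2(2)[of x y] that by (intro mult_strict_left_mono add_strict_mono) auto
    also have "\<dots> = \<epsilon>" using \<open>C' > 0\<close> by simp
    finally show ?thesis .
  qed
  with K1(1) K2(1) show "\<exists>K. compactin T K \<and>
        (\<forall>x\<in>topspace T - K. \<forall>y\<in>topspace T. d x y \<le> R \<longrightarrow> cmod (h x - h y) < \<epsilon>)"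
    by (meson compactin_Un)
qed

lemma higson_algebra_one: "(\<lambda>x\<in>topspace T. 1) \<in> higson_algebra T d"
  by (rule higson_algebraI[where B = 1]) (auto intro!: exI[of _ "{}"])

lemma higson_algebra_add:
  assumes f: "f \<in> higson_algebra T d" and g: "g \<in> higson_algebra T d"
  shows "(\<lambda>x\<in>topspace T. f x + g x) \<in> higson_algebra T d"
proof -
  obtain A where A: "\<And>x. x \<in> topspace T \<Longrightarrow> cmod (f x) \<le> A"
    using higson_algebra_bounded[OF f] by blast
  obtain B where B: "\<And>x. x \<in> topspace T \<Longrightarrow> cmod (g x) \<le> B"
    using higson_algebra_bounded[OF g] by blast
  have "cmod (f x + g x) \<le> A + B" if "x \<in> topspace T" for x
    using A[OF that] B[OF that] norm_triangle_ineq[of "f x" "g x"] by linarith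
  moreover have "cmod (f x + g x - (f y + g y)) \<le> 1 * (cmod (f x - f y) + cmod (g x - g y))" for x y
    by (metis norm_diff_triangle_ineq mult_1)
  ultimately show ?thesis
    using continuous_map_add[OF f[THEN higson_algebra_continuous] g[THEN higson_algebra_continuous]]
    by (intro higson_algebra_lipschitz[OF f g])
qed

lemma higson_algebra_mult:
  assumes f: "f \<in> higson_algebra T d" and g: "g \<in> higson_algebra T d"
  shows "(\<lambda>x\<in>topspace T. f x * g x) \<in> higson_algebra T d"
proof -
  obtain A where A: "\<And>x. x \<in> topspace T \<Longrightarrow> cmod (f x) \<le> A"
    using higson_algebra_bounded[OF f] by blast
  obtain B where B: "\<And>x. x \<in> topspace T \<Longrightarrow> cmod (g x) \<le> B"
    using higson_algebra_bounded[OF g] by blast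
  have "cmod (f x * g x) \<le> A * B" if "x \<in> topspace T" for x
    using A[OF that] B[OF that] unfolding norm_mult
    by (intro mult_mono) (auto intro: order_trans[OF norm_ge_zero])
  moreover have "cmod (f x * g x - f y * g y) \<le> max A B * (cmod (f x - f y) + cmod (g x - g y))"
    if "x \<in> topspace T" "y \<in> topspace T" for x y
  proof -
    have "f x * g x - f y * g y = f x * (g x - g y) + g y * (f x - f y)" by (simp add: algebra_simps)
    then have "cmod (f x * g x - f y * g y) \<le> cmod (f x) * cmod (g x - g y) + cmod (g y) * cmod (f x - f y)"
      by (metis norm_mult norm_triangle_ineq)
    also have "\<dots> \<le> max A B * cmod (g x - g y) + max A B * cmod (f x - f y)"
      using A[OF that(1)] B[OF that(2)] by (intro add_mono mult_right_mono) auto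
    finally show ?thesis by (simp add: algebra_simps)
  qed
  moreover have "continuous_map T euclidean (\<lambda>x. f x * g x)"
    using f[THEN higson_algebra_continuous] g[THEN higson_algebra_continuous]
    by (fastforce simp: continuous_map_atin tendsto_mult)
  ultimately show ?thesis by (intro higson_algebra_lipschitz[OF f g])
qed

lemma higson_algebra_cnj:
  assumes f: "f \<in> higson_algebra T d"
  shows "(\<lambda>x\<in>topspace T. cnj (f x)) \<in> higson_algebra T d"
proof -
  obtain A where A: "\<And>x. x \<in> topspace T \<Longrightarrow> cmod (f x) \<le> A"
    using higson_algebra_bounded[OF f] by blast
  have "cmod (cnj (f x) - cnj (f y)) \<le> 1 * (cmod (f x - f y) + cmod (f x - f y))" for x y
    by (metis complex_cnj_diff complex_mod_cnj le_add_same_cancel1 mult_1 norm_ge_zero)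
  moreover have "continuous_map T euclidean (\<lambda>x. cnj (f x))"
    using f[THEN higson_algebra_continuous]
    by (fastforce simp: continuous_map_atin tendsto_cnj)
  moreover have "cmod (cnj (f x)) \<le> A" if "x \<in> topspace T" for x using A[OF that] by simp
  ultimately show ?thesis by (intro higson_algebra_lipschitz[OF f f])
qed

lemma higson_algebra_scale:
  assumes f: "f \<in> higson_algebra T d"
  shows "(\<lambda>x\<in>topspace T. a * f x) \<in> higson_algebra T d"
proof -
  obtain A where A: "\<And>x. x \<in> topspace T \<Longrightarrow> cmod (f x) \<le> A"
    using higson_algebra_bounded[OF f] by blast
  have "cmod (a * f x - a * f y) \<le> cmod a * (cmod (f x - f y) + cmod (f x - f y))" for x y
    by (auto simp: norm_mult simp flip: right_diff_distrib intro!: mult_left_mono)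
  moreover have "continuous_map T euclidean (\<lambda>x. a * f x)"
    using f[THEN higson_algebra_continuous]
    by (fastforce simp: continuous_map_atin tendsto_mult)
  moreover have "cmod (a * f x) \<le> cmod a * A" if "x \<in> topspace T" for x
    using A[OF that] by (auto simp: norm_mult intro!: mult_left_mono)
  ultimately show ?thesis by (intro higson_algebra_lipschitz[OF f f])
qed

text \<open>Inversion is Lipschitz outside a disc around zero, with the square of
  \<open>inverse \<delta>\<close> as constant. This is what excludes such functions from the kernels
  of characters.\<close>

lemma higson_algebra_inverse:
  assumes f: "f \<in> higson_algebra T d" and "0 < \<delta>" and \<delta>: "\<And>x. x \<in> topspace T \<Longrightarrow> \<delta> \<le> cmod (f x)"
  shows "(\<lambda>x\<in>topspace T. inverse (f x)) \<in> higson_algebra T d"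
proof -
  have nz: "f x \<noteq> 0" if "x \<in> topspace T" for x using \<delta>[OF that] \<open>0 < \<delta>\<close> by auto
  have le: "cmod (inverse (f x)) \<le> inverse \<delta>" if "x \<in> topspace T" for x
    using \<delta>[OF that] \<open>0 < \<delta>\<close> by (simp add: norm_inverse le_imp_inverse_le)
  have "cmod (inverse (f x) - inverse (f y)) \<le> inverse \<delta> * inverse \<delta> * (cmod (f x - f y) + cmod (f x - f y))"
    if "x \<in> topspace T" "y \<in> topspace T" for x y
  proof -
    have "inverse (f x) - inverse (f y) = - (inverse (f x) * inverse (f y) * (f x - f y))"
      using nz that by (simp add: field_simps)
    then have "cmod (inverse (f x) - inverse (f y)) = cmod (inverse (f x)) * cmod (inverse (f y)) * cmod (f x - f y)"
      by (metis norm_minus_cancel norm_mult)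
    also have "\<dots> \<le> inverse \<delta> * inverse \<delta> * (cmod (f x - f y) + cmod (f x - f y))"
      using le that \<open>0 < \<delta>\<close> by (intro mult_mono) auto
    finally show ?thesis .
  qed
  moreover have "continuous_map T euclidean (\<lambda>x. inverse (f x))"
    using f[THEN higson_algebra_continuous] nz
    by (fastforce simp: continuous_map_atin tendsto_inverse)
  ultimately show ?thesis using le by (intro higson_algebra_lipschitz[OF f f])
qed

section \<open>Characters and their kernels\<close>

context
  fixes e assumes e: "e \<in> higson_characters T d"
begin

lemma character_one: "e (\<lambda>x\<in>topspace T. 1) = 1"
  and character_add: "f \<in> higson_algebra T d \<Longrightarrow> g \<in> higson_algebra T d \<Longrightarrow>
    e (\<lambda>x\<in>topspace T. f x + g x) = e f + e g"
  and character_mult: "f \<in> higson_algebra T d \<Longrightarrow> g \<in> higson_algebra T d \<Longrightarrow>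
    e (\<lambda>x\<in>topspace T. f x * g x) = e f * e g"
  and character_scale: "f \<in> higson_algebra T d \<Longrightarrow> e (\<lambda>x\<in>topspace T. a * f x) = a * e f"
  using e by (auto simp: higson_characters_def)

lemma character_nonzero:
  assumes f: "f \<in> higson_algebra T d" and "0 < \<delta>" and \<delta>: "\<And>x. x \<in> topspace T \<Longrightarrow> \<delta> \<le> cmod (f x)"
  shows "e f \<noteq> 0"
proof -
  define g where "g = (\<lambda>x\<in>topspace T. inverse (f x))"
  have g: "g \<in> higson_algebra T d"
    unfolding g_def using assms by (rule higson_algebra_inverse)
  have "(\<lambda>x\<in>topspace T. f x * g x) = (\<lambda>x\<in>topspace T. 1)"
  proof (rule restrict_ext)
    fix x assume "x \<in> topspace T"
    with \<delta> \<open>0 < \<delta>\<close> have "f x \<noteq> 0" by fastforce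
    with \<open>x \<in> topspace T\<close> show "f x * g x = 1" by (simp add: g_def)
  qed
  then have "e f * e g = 1" using character_mult[OF f g] character_one by simp
  then show ?thesis by auto
qed

text \<open>The squared modulus is \<open>f - e f\<close> times its conjugate, and the first factor
  is in the kernel of \<open>e\<close>.\<close>

lemma character_deviation:
  assumes f: "f \<in> higson_algebra T d"
  defines "g \<equiv> \<lambda>x\<in>topspace T. complex_of_real ((cmod (f x - e f))\<^sup>2)"
  shows "g \<in> higson_algebra T d" "e g = 0"
proof -
  \<comment> \<open>The constant \<open>- e f\<close> is written as a multiple of the unit, so that
    \<open>character_scale\<close> evaluates \<open>e\<close> on it.\<close>
  define c where "c = (\<lambda>x\<in>topspace T. - e f * (\<lambda>x\<in>topspace T. 1) x)"
  define f1 where "f1 = (\<lambda>x\<in>topspace T. f x + c x)"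
  define f2 where "f2 = (\<lambda>x\<in>topspace T. cnj (f1 x))"
  have c: "c \<in> higson_algebra T d" "e c = - e f"
    unfolding c_def using higson_algebra_scale[OF higson_algebra_one] character_scale[OF higson_algebra_one]
    by (simp_all only: character_one mult_1_right)
  have f1: "f1 \<in> higson_algebra T d" "e f1 = 0"
    unfolding f1_def using higson_algebra_add[OF f c(1)] character_add[OF f c(1)] c(2) by auto
  have f2: "f2 \<in> higson_algebra T d"
    unfolding f2_def using higson_algebra_cnj[OF f1(1)] .
  have "g = (\<lambda>x\<in>topspace T. f1 x * f2 x)"
    unfolding g_def complex_norm_square by (rule restrict_ext) (simp add: f1_def f2_def c_def)
  then show "g \<in> higson_algebra T d" "e g = 0"
    using higson_algebra_mult[OF f1(1) f2] character_mult[OF f1(1) f2] f1(2) by auto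
qed

text \<open>One kernel element controls finitely many functions at once: it is small at a point only
  if every \<open>f x\<close> is close to \<open>e f\<close> there.\<close>

lemma character_deviation_sum:
  assumes "finite \<F>" "\<F> \<subseteq> higson_algebra T d"
  shows "(\<lambda>x\<in>topspace T. complex_of_real (\<Sum>f\<in>\<F>. (cmod (f x - e f))\<^sup>2)) \<in> higson_algebra T d
    \<and> e (\<lambda>x\<in>topspace T. complex_of_real (\<Sum>f\<in>\<F>. (cmod (f x - e f))\<^sup>2)) = 0"
  using assms
proof (induction \<F>)
  case empty
  show ?case
    using higson_algebra_scale[OF higson_algebra_one, of 0] character_scale[OF higson_algebra_one, of 0]
    by (simp only: sum.empty of_real_0 mult_zero_left simp_thms)
next
  case (insert g \<F>)
  define u v where "u = (\<lambda>x\<in>topspace T. complex_of_real ((cmod (g x - e g))\<^sup>2))"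
    and "v = (\<lambda>x\<in>topspace T. complex_of_real (\<Sum>f\<in>\<F>. (cmod (f x - e f))\<^sup>2))"
  have uv: "u \<in> higson_algebra T d" "e u = 0" "v \<in> higson_algebra T d" "e v = 0"
    using insert.IH insert.prems character_deviation[of g] unfolding u_def v_def by blast+
  have "(\<lambda>x\<in>topspace T. complex_of_real (\<Sum>f\<in>insert g \<F>. (cmod (f x - e f))\<^sup>2))
      = (\<lambda>x\<in>topspace T. u x + v x)"
    using insert.hyps by (auto simp: u_def v_def)
  moreover have "e (\<lambda>x\<in>topspace T. u x + v x) = 0"
    using character_add[OF uv(1,3)] uv(2,4) by (simp only: add_0)
  ultimately show ?case using higson_algebra_add[OF uv(1,3)] by (simp only: simp_thms)
qed

text \<open>If no evaluation agreed with \<open>e\<close>, then by compactness finitely many elements of the kernel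
  of \<open>e\<close> could be added to the given one to get an invertible element of the kernel.\<close>

lemma character_evaluation:
  assumes g: "(\<lambda>x\<in>topspace T. complex_of_real (g x)) \<in> higson_algebra T d"
      "e (\<lambda>x\<in>topspace T. complex_of_real (g x)) = 0"
    and nonneg: "\<And>x. x \<in> topspace T \<Longrightarrow> 0 \<le> g x"
    and K: "compactin T K" and "0 < \<delta>" and \<delta>: "\<And>x. x \<in> topspace T - K \<Longrightarrow> \<delta> \<le> g x"
  shows "e \<in> higson_embedding T d ` topspace T"
proof (rule ccontr)
  assume contra: "\<not> ?thesis"
  let ?A = "higson_algebra T d"
  define U where "U f = {y \<in> topspace T. f y \<in> - {e f}}" for f
  have cover: "K \<subseteq> \<Union>(U ` ?A)"
  proof
    fix x assume "x \<in> K"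
    then have x: "x \<in> topspace T" using compactin_subset_topspace[OF K] by blast
    with contra have "e \<noteq> higson_embedding T d x" by blast
    \<comment> \<open>Both functionals are extensional, so if they differ, they differ at a member
      of the algebra.\<close>
    moreover have "e \<in> extensional ?A" using e by (simp add: higson_characters_def)
    moreover have "higson_embedding T d x \<in> extensional ?A" by (simp add: higson_embedding_def)
    ultimately obtain f where "f \<in> ?A" "e f \<noteq> higson_embedding T d x f"
      by (meson extensionalityI)
    then show "x \<in> \<Union>(U ` ?A)" using x by (fastforce simp: U_def higson_embedding_def)
  qed
  have "openin T (U f)" if "f \<in> ?A" for f
    unfolding U_def using higson_algebra_continuous[OF that]
    by (rule openin_continuous_map_preimage) (simp add: open_Compl)
  then obtain \<V> where "finite \<V>" "\<V> \<subseteq> U ` ?A" "K \<subseteq> \<Union>\<V>"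
    using compactinD[OF K _ cover] by blast
  then obtain \<F> where \<F>: "finite \<F>" "\<F> \<subseteq> ?A" "K \<subseteq> \<Union>(U ` \<F>)"
    by (metis finite_subset_image)
  define h where "h x = (\<Sum>f\<in>\<F>. (cmod (f x - e f))\<^sup>2)" for x
  have h: "(\<lambda>x\<in>topspace T. complex_of_real (h x)) \<in> ?A" "e (\<lambda>x\<in>topspace T. complex_of_real (h x)) = 0"
    using character_deviation_sum[OF \<F>(1,2)] by (auto simp: h_def)
  have h0: "0 \<le> h x" for x by (simp add: h_def sum_nonneg)
  have hpos: "0 < h x" if x: "x \<in> K" for x
  proof -
    obtain f where "f \<in> \<F>" "f x \<noteq> e f" using \<F>(3) x unfolding U_def by blast
    then show ?thesis unfolding h_def using \<F>(1) by (intro sum_pos2[of _ f]) auto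
  qed
  have "continuous_map T euclideanreal h"
    unfolding h_def using \<F>(1,2) higson_algebra_continuous
    by (intro continuous_intros) auto
  then have comp: "compact (h ` K)" using image_compactin[OF K, of euclideanreal h] by simp
  obtain m where m: "0 < m" "\<And>x. x \<in> K \<Longrightarrow> m \<le> h x"
  \<comment> \<open>On an empty \<open>K\<close> no minimum is attained, and any positive
    \<open>m\<close> serves.\<close>
  proof (cases "K = {}")
    case False
    then obtain x where "x \<in> K" "\<forall>y\<in>K. h x \<le> h y"
      using compact_attains_inf[OF comp] by auto
    then show thesis using that[of "h x"] hpos by blast
  qed (use that[of 1] in auto)
  define k where "k = (\<lambda>x\<in>topspace T. (\<lambda>x\<in>topspace T. complex_of_real (g x)) x + (\<lambda>x\<in>topspace T. complex_of_real (h x)) x)"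
  have k: "k \<in> ?A" "e k = 0"
    unfolding k_def using higson_algebra_add[OF g(1) h(1)] character_add[OF g(1) h(1)] g(2) h(2) by simp_all
  \<comment> \<open>The lower bound comes from \<open>h\<close> on \<open>K\<close> and from
    \<open>g\<close> outside it; both are nonnegative, so neither cancels the other.\<close>
  have "min m \<delta> \<le> cmod (k x)" if "x \<in> topspace T" for x
  proof -
    have "k x = complex_of_real (g x + h x)" using that by (simp add: k_def)
    then have "cmod (k x) = g x + h x" using nonneg[OF that] h0[of x] by (simp only: norm_of_real)
    moreover have "m \<le> h x \<or> \<delta> \<le> g x" using \<delta> m that by blast
    ultimately show ?thesis using nonneg[OF that] h0[of x] by linarith
  qed
  then show False using character_nonzero[OF k(1), of "min m \<delta>"] k(2) m(1) \<open>0 < \<delta>\<close> by simp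
qed

end

section \<open>The space of characters\<close>

lemma higson_embedding_character:
  assumes "x \<in> topspace T"
  shows "higson_embedding T d x \<in> higson_characters T d"
  using assms
  by (simp add: higson_characters_def higson_embedding_def higson_algebra_one higson_algebra_add
      higson_algebra_mult higson_algebra_scale higson_algebra_cnj)

lemma topspace_higson_compactification:
  "topspace (higson_compactification T d) = higson_characters T d"
  by (auto simp: higson_compactification_def higson_characters_def PiE_def)

text \<open>Instead of a convergent subsequence of evaluations, a cluster point is taken: a common
  point of the closures of all tails in a product of discs, which is compact by Tychonoff. The
  identities defining a character are closed conditions that hold along the sequence, hence at
  \<open>e\<close>; so is closeness to a limit of \<open>f (x k)\<close>.\<close>

lemma character_limit:
  fixes x :: "nat \<Rightarrow> 'a"
  assumes x: "\<And>k. x k \<in> topspace T"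
  obtains e where "e \<in> higson_characters T d"
    "\<And>f l. f \<in> higson_algebra T d \<Longrightarrow> (\<lambda>k. f (x k)) \<longlonglongrightarrow> l \<Longrightarrow> e f = l"
proof -
  let ?A = "higson_algebra T d" and ?E = "higson_embedding T d"
  have "\<exists>b. \<forall>y\<in>topspace T. cmod (f y) \<le> b" if "f \<in> ?A" for f
    using higson_algebra_bounded[OF that] by metis
  then obtain B where B: "\<And>f y. f \<in> ?A \<Longrightarrow> y \<in> topspace T \<Longrightarrow> cmod (f y) \<le> B f" by metis
  define P where "P = product_topology (\<lambda>f. top_of_set (cball (0::complex) (B f))) ?A"
  have comp: "compact_space P"
    unfolding P_def by (subst compact_space_product_topology) (simp add: compact_space_subtopology)
  have in_P: "?E (x k) \<in> topspace P" for k
    using B x by (auto simp: P_def higson_embedding_def)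
  define C where "C n = P closure_of ((?E \<circ> x) ` {n..})" for n
  have C_ne: "C n \<noteq> {}" for n
  proof -
    have "?E (x n) \<in> (?E \<circ> x) ` {n..}" by auto
    then have "?E (x n) \<in> C n" unfolding C_def using in_P closure_of_subset_Int[of P] by fastforce
    then show ?thesis by blast
  qed
  moreover have "decseq C" unfolding C_def by (intro decseq_SucI closure_of_mono image_mono) auto
  ultimately obtain e where e: "\<And>n. e \<in> C n"
    using compact_space_imp_nest[OF comp, of C] by (fastforce simp: C_def)
  have closedD: "e \<in> S" if "closedin P S" "\<And>k. k \<ge> n \<Longrightarrow> ?E (x k) \<in> S" for S n
    using closure_of_minimal[OF _ that(1), of "(?E \<circ> x) ` {n..}"] that(2) e[of n] by (auto simp: C_def)
  have eqD: "a e = b e" if "continuous_map P euclidean a" "continuous_map P euclidean b"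
    "\<And>k. a (?E (x k)) = b (?E (x k))" for a b :: "(('a \<Rightarrow> complex) \<Rightarrow> complex) \<Rightarrow> complex"
  proof -
    have "e \<in> {\<omega> \<in> topspace P. a \<omega> = b \<omega>}"
      using that in_P by (intro closedD[of _ 0] closedin_continuous_maps_eq[of euclidean]) auto
    then show ?thesis by simp
  qed
  have coord: "continuous_map P euclidean (\<lambda>\<omega>. \<omega> f)" if "f \<in> ?A" for f
    using continuous_map_product_projection[OF that, of "\<lambda>f. top_of_set (cball (0::complex) (B f))"]
    by (simp add: P_def continuous_map_in_subtopology)
  have "e \<in> topspace P"
    using subsetD[OF closure_of_subset_topspace e[of 0, unfolded C_def]] .
  then have ext: "e \<in> extensional ?A" by (auto simp: P_def PiE_def)
  have "e (\<lambda>x\<in>topspace T. 1) = 1"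
    using x higson_algebra_one by (intro eqD[OF coord[OF higson_algebra_one], of "\<lambda>_. 1"]) (auto simp: higson_embedding_def)
  moreover have "e (\<lambda>x\<in>topspace T. f x + g x) = e f + e g" if "f \<in> ?A" "g \<in> ?A" for f g
    using x that higson_algebra_add[OF that]
    by (intro eqD[OF coord[OF higson_algebra_add[OF that]], of "\<lambda>\<omega>. \<omega> f + \<omega> g"]
        continuous_map_add coord) (auto simp: higson_embedding_def)
  moreover have "e (\<lambda>x\<in>topspace T. f x * g x) = e f * e g" if "f \<in> ?A" "g \<in> ?A" for f g
  proof -
    have "continuous_map P euclidean (\<lambda>\<omega>. \<omega> f * \<omega> g)"
      using coord[OF that(1)] coord[OF that(2)] by (fastforce simp: continuous_map_atin tendsto_mult)
    then show ?thesis
      using x that higson_algebra_mult[OF that]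
      by (intro eqD[OF coord[OF higson_algebra_mult[OF that]], of "\<lambda>\<omega>. \<omega> f * \<omega> g"]) (auto simp: higson_embedding_def)
  qed
  moreover have "e (\<lambda>x\<in>topspace T. a * f x) = a * e f" if "f \<in> ?A" for f a
  proof -
    have "continuous_map P euclidean (\<lambda>\<omega>. a * \<omega> f)"
      using coord[OF that] by (fastforce simp: continuous_map_atin tendsto_mult)
    then show ?thesis
      using x that higson_algebra_scale[OF that]
      by (intro eqD[OF coord[OF higson_algebra_scale[OF that]], of "\<lambda>\<omega>. a * \<omega> f"]) (auto simp: higson_embedding_def)
  qed
  moreover have "e (\<lambda>x\<in>topspace T. cnj (f x)) = cnj (e f)" if "f \<in> ?A" for f
  proof -
    have "continuous_map P euclidean (\<lambda>\<omega>. cnj (\<omega> f))"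
      using coord[OF that] by (fastforce simp: continuous_map_atin tendsto_cnj)
    then show ?thesis
      using x that higson_algebra_cnj[OF that]
      by (intro eqD[OF coord[OF higson_algebra_cnj[OF that]], of "\<lambda>\<omega>. cnj (\<omega> f)"]) (auto simp: higson_embedding_def)
  qed
  ultimately have "e \<in> higson_characters T d"
    using ext by (simp add: higson_characters_def)
  moreover have "e f = l" if f: "f \<in> ?A" and l: "(\<lambda>k. f (x k)) \<longlonglongrightarrow> l" for f l
  proof -
    have "dist (e f) l \<le> \<epsilon>" if "0 < \<epsilon>" for \<epsilon>
    proof -
      obtain n where n: "\<And>k. k \<ge> n \<Longrightarrow> dist (f (x k)) l < \<epsilon>"
        using l \<open>0 < \<epsilon>\<close> by (meson lim_sequentially)
      have "e \<in> {\<omega> \<in> topspace P. \<omega> f \<in> cball l \<epsilon>}"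
      proof (rule closedD)
        show "closedin P {\<omega> \<in> topspace P. \<omega> f \<in> cball l \<epsilon>}"
          using coord[OF f] by (rule closedin_continuous_map_preimage) simp
        show "?E (x k) \<in> {\<omega> \<in> topspace P. \<omega> f \<in> cball l \<epsilon>}" if "k \<ge> n" for k
          using n[OF that] in_P f by (auto simp: higson_embedding_def dist_commute)
      qed
      then show ?thesis by (simp add: dist_commute)
    qed
    then show ?thesis by (metis dense_ge dist_le_zero_iff)
  qed
  ultimately show thesis using that by blast
qed

end

section \<open>Charts and the leaf topology\<close>

text \<open>Indexing plaques by points instead of transversal coordinates makes lying on a common
  plaque a relation between points. For \<open>p\<close> outside the domain the coordinate is
  arbitrary.\<close>

definition plaque_at :: "('a, 'n::finite, 'z) chart \<Rightarrow> 'a \<Rightarrow> 'a set" where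
  "plaque_at c p = {q \<in> chart_dom c. snd (chart_map c q) = snd (chart_map c p)}"

lemma plaque_at_self: "p \<in> chart_dom c \<Longrightarrow> p \<in> plaque_at c p"
  by (simp add: plaque_at_def)

lemma plaque_at_eq: "q \<in> plaque_at c p \<Longrightarrow> plaque_at c q = plaque_at c p"
  by (auto simp: plaque_at_def)

section \<open>Geometry of a single chart\<close>

context
  fixes X :: "'a topology" and c :: "('a, 'n::finite, 'z) chart"
  assumes c: "is_chart X c"
begin

lemma chart_dom_openin: "openin X (chart_dom c)"
  using c by (simp add: is_chart_def)

lemma chart_dom_subset: "chart_dom c \<subseteq> topspace X"
  using chart_dom_openin by (rule openin_subset)

lemma chart_homeomorphic_map:
  "homeomorphic_map (subtopology X (chart_dom c))
     (prod_topology (top_of_set (chart_ball c)) (chart_trans c)) (chart_map c)"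
  using c by (simp add: is_chart_def)

lemma chart_map_image: "chart_map c ` chart_dom c = chart_ball c \<times> topspace (chart_trans c)"
  using homeomorphic_imp_surjective_map[OF chart_homeomorphic_map] chart_dom_subset
  by (simp add: Int_absorb1)

lemma chart_trans_Hausdorff: "Hausdorff_space (chart_trans c)"
  using c by (simp add: is_chart_def completely_metrizable_imp_metrizable_space metrizable_imp_Hausdorff_space)

text \<open>Surjectivity of the chart makes every plaque nonempty: the centre of the ball supplies a
  point over each transversal coordinate.\<close>

lemma plaques_eq: "plaques c = plaque_at c ` chart_dom c"
proof -
  obtain a r where "0 < r" "chart_ball c = ball a r" using c by (auto simp: is_chart_def)
  then have a: "a \<in> chart_ball c" by simp
  have mem: "chart_map c q \<in> chart_ball c \<times> topspace (chart_trans c)" if "q \<in> chart_dom c" for q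
    using chart_map_image that by blast
  have eq: "chart_dom c \<inter> chart_map c -` (chart_ball c \<times> {snd (chart_map c p)}) = plaque_at c p" for p
    using mem by (fastforce simp: plaque_at_def)
  show ?thesis
  proof (intro equalityI subsetI)
    fix P assume "P \<in> plaques c"
    then obtain z where z: "z \<in> topspace (chart_trans c)" "P = chart_dom c \<inter> chart_map c -` (chart_ball c \<times> {z})"
      by (auto simp: plaques_def)
    then have "(a, z) \<in> chart_map c ` chart_dom c" using a chart_map_image by simp
    then obtain p where "p \<in> chart_dom c" "chart_map c p = (a, z)" by force
    then show "P \<in> plaque_at c ` chart_dom c" using eq[of p] z(2) by auto
  next
    fix P assume "P \<in> plaque_at c ` chart_dom c"
    then obtain p where p: "p \<in> chart_dom c" "P = plaque_at c p" by blast
    then have "snd (chart_map c p) \<in> topspace (chart_trans c)" using mem[OF p(1)] by (simp add: mem_Times_iff)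
    then show "P \<in> plaques c" unfolding plaques_def using p(2) eq[of p] by blast
  qed
qed

lemma continuous_map_transversal:
  "continuous_map (subtopology X (chart_dom c)) (chart_trans c) (\<lambda>p. snd (chart_map c p))"
  using continuous_map_compose[OF homeomorphic_imp_continuous_map[OF chart_homeomorphic_map] continuous_map_snd]
  by (simp add: comp_def)

lemma openin_transversal_image:
  assumes "openin X W"
  shows "openin (chart_trans c) ((\<lambda>p. snd (chart_map c p)) ` (W \<inter> chart_dom c))"
proof -
  have "openin (subtopology X (chart_dom c)) (W \<inter> chart_dom c)"
    using assms by (auto simp: openin_subtopology)
  then have "openin (prod_topology (top_of_set (chart_ball c)) (chart_trans c)) (chart_map c ` (W \<inter> chart_dom c))"
    using homeomorphic_imp_open_map[OF chart_homeomorphic_map] by (auto simp: open_map_def)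
  then show ?thesis
    using open_map_snd[of "top_of_set (chart_ball c)" "chart_trans c"] by (auto simp: open_map_def image_image)
qed

lemma connectedin_plaque:
  assumes "p \<in> chart_dom c"
  shows "connectedin X (plaque_at c p)"
proof -
  let ?S = "subtopology X (chart_dom c)"
  let ?Y = "prod_topology (top_of_set (chart_ball c)) (chart_trans c)"
  let ?z = "snd (chart_map c p)"
  obtain g where g: "homeomorphic_maps ?S ?Y (chart_map c) g"
    using chart_homeomorphic_map homeomorphic_map_maps by blast
  have top: "topspace ?S = chart_dom c" using chart_dom_subset by (simp add: Int_absorb1)
  have mem: "chart_map c q \<in> chart_ball c \<times> topspace (chart_trans c)" if "q \<in> chart_dom c" for q
    using chart_map_image that by blast
  then have z: "?z \<in> topspace (chart_trans c)" using assms by (simp add: mem_Times_iff)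
  obtain a r where "chart_ball c = ball a r" using c by (auto simp: is_chart_def)
  then have "connectedin (top_of_set (chart_ball c)) (chart_ball c)"
    by (simp add: connectedin_subtopology)
  then have "connectedin ?Y (chart_ball c \<times> {?z})"
    using z by (simp add: connectedin_Times)
  then have "connectedin ?S (g ` (chart_ball c \<times> {?z}))"
    using g connectedin_continuous_map_image[of ?Y ?S g] by (simp only: homeomorphic_maps_def)
  moreover have "g ` (chart_ball c \<times> {?z}) = plaque_at c p"
  proof (intro equalityI subsetI)
    fix q assume "q \<in> g ` (chart_ball c \<times> {?z})"
    then obtain b where b: "b \<in> chart_ball c" "q = g (b, ?z)" by blast
    then have bz: "(b, ?z) \<in> topspace ?Y" using z by simp
    have gS: "g \<in> topspace ?Y \<rightarrow> topspace ?S"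
      using g unfolding homeomorphic_maps_def continuous_map_def by (elim conjE)
    have gY: "\<forall>y\<in>topspace ?Y. chart_map c (g y) = y"
      using g unfolding homeomorphic_maps_def by (elim conjE)
    have "g (b, ?z) \<in> chart_dom c" using funcset_mem[OF gS bz] unfolding top .
    moreover have "chart_map c (g (b, ?z)) = (b, ?z)" using gY bz by (rule bspec)
    ultimately show "q \<in> plaque_at c p" using b by (simp add: plaque_at_def)
  next
    fix q assume "q \<in> plaque_at c p"
    then have q: "q \<in> chart_dom c" "snd (chart_map c q) = ?z" by (auto simp: plaque_at_def)
    have "\<forall>x\<in>topspace ?S. g (chart_map c x) = x"
      using g unfolding homeomorphic_maps_def by (elim conjE)
    then have "q = g (chart_map c q)" using q(1) unfolding top by simp
    moreover have "chart_map c q \<in> chart_ball c \<times> {?z}" using mem[OF q(1)] q(2) by (simp add: mem_Times_iff)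
    ultimately show "q \<in> g ` (chart_ball c \<times> {?z})" by (rule image_eqI)
  qed
  ultimately show ?thesis by (simp add: connectedin_subtopology)
qed

text \<open>Shrinking charts into a given neighbourhood is what later makes the leaf topology finer
  than that of \<open>X\<close>. A basic product neighbourhood is cut down to a round ball times an
  open part of the transversal: \<open>is_chart\<close> demands a ball, and openness preserves local
  compactness and complete metrizability.\<close>

lemma small_chart:
  assumes p: "p \<in> chart_dom c" and W: "openin X W" "p \<in> W"
  obtains c' where "is_chart X c'" "p \<in> chart_dom c'" "chart_dom c' \<subseteq> W \<inter> chart_dom c"
    "chart_map c' = chart_map c"
proof -
  let ?S = "subtopology X (chart_dom c)"
  let ?Y = "prod_topology (top_of_set (chart_ball c)) (chart_trans c)"
  have mem: "chart_map c q \<in> chart_ball c \<times> topspace (chart_trans c)" if "q \<in> chart_dom c" for q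
    using chart_map_image that by blast
  have "openin ?S (W \<inter> chart_dom c)" using W by (auto simp: openin_subtopology)
  then have opn: "openin ?Y (chart_map c ` (W \<inter> chart_dom c))"
    using homeomorphic_imp_open_map[OF chart_homeomorphic_map] by (auto simp: open_map_def)
  have "(fst (chart_map c p), snd (chart_map c p)) \<in> chart_map c ` (W \<inter> chart_dom c)"
    using p W by auto
  then obtain B V where B: "openin (top_of_set (chart_ball c)) B" and V: "openin (chart_trans c) V"
    and pBV: "fst (chart_map c p) \<in> B" "snd (chart_map c p) \<in> V"
    and BV: "B \<times> V \<subseteq> chart_map c ` (W \<inter> chart_dom c)"
    using opn unfolding openin_prod_topology_alt by meson
  obtain a0 r0 where "chart_ball c = ball a0 r0" using c by (auto simp: is_chart_def)
  then have "open (chart_ball c)" by simp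
  with B have "open B" using openin_open_trans by blast
  with pBV(1) obtain r where r: "0 < r" "ball (fst (chart_map c p)) r \<subseteq> B"
    using openE by blast
  define B' where "B' = ball (fst (chart_map c p)) r"
  define D where "D = {q \<in> chart_dom c. chart_map c q \<in> B' \<times> V}"
  define c' where "c' = \<lparr>chart_dom = D, chart_map = chart_map c, chart_ball = B',
    chart_trans = subtopology (chart_trans c) V\<rparr>"
  have VS: "V \<subseteq> topspace (chart_trans c)" using V openin_subset by blast
  have B'S: "B' \<subseteq> chart_ball c" using r(2) B openin_imp_subset unfolding B'_def by blast
  have opB': "openin (top_of_set (chart_ball c)) B'"
    using B'S by (simp add: B'_def open_subset)
  have inj: "inj_on (chart_map c) (chart_dom c)"
    using homeomorphic_imp_injective_map[OF chart_homeomorphic_map] chart_dom_subset by (simp add: Int_absorb1)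
  have DW: "D \<subseteq> W \<inter> chart_dom c"
  proof
    fix q assume q: "q \<in> D"
    have "B' \<times> V \<subseteq> B \<times> V" using r(2) unfolding B'_def by (rule Sigma_mono) simp
    moreover have "chart_map c q \<in> B' \<times> V" using q by (simp add: D_def)
    ultimately have "chart_map c q \<in> chart_map c ` (W \<inter> chart_dom c)" using BV by (meson subsetD)
    then obtain q' where "q' \<in> W \<inter> chart_dom c" "chart_map c q = chart_map c q'" by blast
    then show "q \<in> W \<inter> chart_dom c" using q inj_onD[OF inj, of q q'] by (auto simp: D_def)
  qed
  have "openin ?S {q \<in> topspace ?S. chart_map c q \<in> B' \<times> V}"
    using homeomorphic_imp_continuous_map[OF chart_homeomorphic_map] opB' V
    by (intro openin_continuous_map_preimage) (auto simp: openin_prod_Times_iff)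
  moreover have "{q \<in> topspace ?S. chart_map c q \<in> B' \<times> V} = D"
    using chart_dom_subset by (auto simp: D_def)
  ultimately have "openin ?S D" by simp
  then have "openin X D" using chart_dom_openin openin_trans_full by blast
  moreover have "homeomorphic_map (subtopology X D)
     (prod_topology (top_of_set B') (subtopology (chart_trans c) V)) (chart_map c)"
  proof -
    have "chart_map c ` (topspace ?S \<inter> D) = topspace ?Y \<inter> (B' \<times> V)"
    proof (intro equalityI subsetI)
      fix y assume y: "y \<in> topspace ?Y \<inter> (B' \<times> V)"
      then have "y \<in> chart_map c ` chart_dom c" using chart_map_image by auto
      then obtain q where "q \<in> chart_dom c" "y = chart_map c q" by blast
      then show "y \<in> chart_map c ` (topspace ?S \<inter> D)"
        using y chart_dom_subset by (auto simp: D_def)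
    next
      fix y assume "y \<in> chart_map c ` (topspace ?S \<inter> D)"
      then obtain q where "q \<in> D" "y = chart_map c q" by blast
      then show "y \<in> topspace ?Y \<inter> (B' \<times> V)" using mem[of q] by (simp add: D_def)
    qed
    from homeomorphic_map_subtopologies[OF chart_homeomorphic_map this]
    have "homeomorphic_map (subtopology ?S D) (subtopology ?Y (B' \<times> V)) (chart_map c)" .
    moreover have "subtopology ?S D = subtopology X D"
      using DW by (simp add: subtopology_subtopology Int_absorb1)
    moreover have "subtopology ?Y (B' \<times> V) = prod_topology (top_of_set B') (subtopology (chart_trans c) V)"
      using B'S by (simp add: subtopology_Times subtopology_subtopology Int_absorb1)
    ultimately show ?thesis by simp
  qed
  moreover have "locally_compact_space (subtopology (chart_trans c) V)"
    using c V chart_trans_Hausdorff by (intro locally_compact_space_open_subset) (auto simp: is_chart_def)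
  moreover have "completely_metrizable_space (subtopology (chart_trans c) V)"
    using c V by (intro completely_metrizable_space_openin) (auto simp: is_chart_def)
  moreover have "second_countable (subtopology (chart_trans c) V)"
    using c by (intro second_countable_subtopology) (auto simp: is_chart_def)
  ultimately have "is_chart X c'"
    unfolding is_chart_def c'_def using r(1) by (auto simp: B'_def)
  moreover have "p \<in> chart_dom c'"
    using p pBV r(1) by (auto simp: c'_def D_def B'_def mem_Times_iff)
  ultimately show thesis using that DW by (simp add: c'_def)
qed

end

section \<open>Changes of coordinates and the leaf topology\<close>

lemma foliated_changeE:
  assumes "foliated_change X c d" "p \<in> chart_dom c" "p \<in> chart_dom d"
  obtains W \<xi> h where "openin X W" "p \<in> W" "W \<subseteq> chart_dom c \<inter> chart_dom d"
    "\<forall>q\<in>W. chart_map d q = (\<xi> (chart_map c q), h (snd (chart_map c q)))"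
proof -
  have "\<exists>W. openin X W \<and> p \<in> W \<and> W \<subseteq> chart_dom c \<inter> chart_dom d \<and>
          (\<exists>\<xi> h. \<forall>q\<in>W. chart_map d q = (\<xi> (chart_map c q), h (snd (chart_map c q))))"
    using assms by (simp add: foliated_change_def)
  then show thesis by (elim exE conjE) (rule that)
qed

lemma foliated_change_restrict:
  assumes "foliated_change X c d" "openin X (chart_dom c')" "chart_dom c' \<subseteq> chart_dom c" "chart_map c' = chart_map c"
  shows "foliated_change X c' d"
  unfolding foliated_change_def
proof
  fix p assume p: "p \<in> chart_dom c' \<inter> chart_dom d"
  then obtain W \<xi> h where W: "openin X W" "p \<in> W" "W \<subseteq> chart_dom c \<inter> chart_dom d"
    "\<forall>q\<in>W. chart_map d q = (\<xi> (chart_map c q), h (snd (chart_map c q)))"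
    using p assms(3) by (blast intro: foliated_changeE[OF assms(1)])
  then show "\<exists>W. openin X W \<and> p \<in> W \<and> W \<subseteq> chart_dom c' \<inter> chart_dom d \<and>
          (\<exists>\<xi> h. \<forall>q\<in>W. chart_map d q = (\<xi> (chart_map c' q), h (snd (chart_map c' q))))"
    using p assms(2,4) by (intro exI[of _ "W \<inter> chart_dom c'"]) auto
qed

lemma foliated_change_restrict_right:
  assumes "foliated_change X d c" "openin X (chart_dom c')" "chart_dom c' \<subseteq> chart_dom c" "chart_map c' = chart_map c"
  shows "foliated_change X d c'"
  unfolding foliated_change_def
proof
  fix p assume p: "p \<in> chart_dom d \<inter> chart_dom c'"
  then obtain W \<xi> h where W: "openin X W" "p \<in> W" "W \<subseteq> chart_dom d \<inter> chart_dom c"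
    "\<forall>q\<in>W. chart_map c q = (\<xi> (chart_map d q), h (snd (chart_map d q)))"
    using p assms(3) by (blast intro: foliated_changeE[OF assms(1)])
  then show "\<exists>W. openin X W \<and> p \<in> W \<and> W \<subseteq> chart_dom d \<inter> chart_dom c' \<and>
          (\<exists>\<xi> h. \<forall>q\<in>W. chart_map c' q = (\<xi> (chart_map d q), h (snd (chart_map d q))))"
    using p assms(2,4) by (intro exI[of _ "W \<inter> chart_dom c'"]) auto
qed

locale foliation =
  fixes X :: "'a topology" and \<A> :: "('a, 'n::finite, 'z) chart set"
  assumes atlas: "foliated_atlas X \<A>"
begin

lemma foliated_chart_is_chart: "foliated_chart X \<A> c \<Longrightarrow> is_chart X c"
  by (simp add: foliated_chart_def)

lemma atlas_foliated_chart: "c \<in> \<A> \<Longrightarrow> foliated_chart X \<A> c"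
  using atlas by (simp add: foliated_chart_def foliated_atlas_def)

lemma atlas_cover:
  assumes "p \<in> topspace X"
  obtains c where "c \<in> \<A>" "p \<in> chart_dom c"
  using assms atlas unfolding foliated_atlas_def by blast

lemma small_foliated_chart:
  assumes c: "foliated_chart X \<A> c" and "p \<in> chart_dom c" "openin X W" "p \<in> W"
  obtains c' where "foliated_chart X \<A> c'" "p \<in> chart_dom c'" "chart_dom c' \<subseteq> W"
proof -
  obtain c' where c': "is_chart X c'" "p \<in> chart_dom c'" "chart_dom c' \<subseteq> W \<inter> chart_dom c"
    "chart_map c' = chart_map c"
    using small_chart[OF foliated_chart_is_chart[OF c] assms(2-4)] by blast
  moreover have "foliated_change X c' d \<and> foliated_change X d c'" if "d \<in> \<A>" for d
    using c c'(3,4) chart_dom_openin[OF c'(1)] that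
    by (auto simp: foliated_chart_def intro: foliated_change_restrict foliated_change_restrict_right)
  ultimately show thesis by (intro that[of c']) (simp_all add: foliated_chart_def)
qed

text \<open>Compatibility is postulated only with members of \<open>\<A>\<close>, so two foliated
  charts are compared through an atlas chart around \<open>p\<close>; the transversal parts
  compose.\<close>

lemma transversal_change:
  assumes c: "foliated_chart X \<A> c" and b: "foliated_chart X \<A> b" and p: "p \<in> chart_dom c" "p \<in> chart_dom b"
  obtains W h where "openin X W" "p \<in> W" "W \<subseteq> chart_dom c \<inter> chart_dom b"
    "\<And>q. q \<in> W \<Longrightarrow> snd (chart_map b q) = h (snd (chart_map c q))"
proof -
  have "p \<in> topspace X" using p chart_dom_subset[OF foliated_chart_is_chart[OF c]] by blast
  then obtain d where d: "d \<in> \<A>" "p \<in> chart_dom d" using atlas_cover by blast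
  have "foliated_change X c d" "foliated_change X d b"
    using b c d by (auto simp: foliated_chart_def)
  obtain W1 \<xi>1 h1 where W1: "openin X W1" "p \<in> W1" "W1 \<subseteq> chart_dom c \<inter> chart_dom d"
      "\<forall>q\<in>W1. chart_map d q = (\<xi>1 (chart_map c q), h1 (snd (chart_map c q)))"
    using p d by (blast intro: foliated_changeE[OF \<open>foliated_change X c d\<close>])
  obtain W2 \<xi>2 h2 where W2: "openin X W2" "p \<in> W2" "W2 \<subseteq> chart_dom d \<inter> chart_dom b"
      "\<forall>q\<in>W2. chart_map b q = (\<xi>2 (chart_map d q), h2 (snd (chart_map d q)))"
    using p d by (blast intro: foliated_changeE[OF \<open>foliated_change X d b\<close>])
  show thesis
    using W1 W2 by (intro that[of "W1 \<inter> W2" "\<lambda>z. h2 (h1 z)"]) auto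
qed

lemma openin_leaf_plaque:
  assumes "foliated_chart X \<A> c" "p \<in> chart_dom c"
  shows "openin (leaf_topology X \<A>) (plaque_at c p)"
  unfolding leaf_topology_def
  using assms by (intro topology_generated_by_Basis) (auto simp: plaques_eq[OF foliated_chart_is_chart])

lemma topspace_leaf_topology: "topspace (leaf_topology X \<A>) = topspace X"
proof (intro equalityI subsetI)
  fix p assume "p \<in> topspace (leaf_topology X \<A>)"
  then obtain c P where "foliated_chart X \<A> c" "P \<in> plaques c" "p \<in> P"
    by (auto simp: leaf_topology_def)
  then show "p \<in> topspace X"
    using chart_dom_subset[OF foliated_chart_is_chart] by (auto simp: plaques_def)
next
  fix p assume "p \<in> topspace X"
  then obtain c where "c \<in> \<A>" "p \<in> chart_dom c" using atlas_cover by blast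
  then have "plaque_at c p \<subseteq> topspace (leaf_topology X \<A>)"
    by (intro openin_subset openin_leaf_plaque atlas_foliated_chart)
  then show "p \<in> topspace (leaf_topology X \<A>)"
    using plaque_at_self[OF \<open>p \<in> chart_dom c\<close>] by blast
qed

text \<open>A small chart inside \<open>W\<close> has its plaques inside \<open>W\<close>, so each
  point of \<open>W\<close> has a plaque as a leaf neighbourhood in \<open>W\<close>.\<close>

lemma openin_leaf_topology:
  assumes "openin X W"
  shows "openin (leaf_topology X \<A>) W"
proof (subst openin_subopen, intro ballI)
  fix p assume p: "p \<in> W"
  then have "p \<in> topspace X" using assms openin_subset by blast
  then obtain c where "c \<in> \<A>" "p \<in> chart_dom c" using atlas_cover by blast
  then obtain c' where c': "foliated_chart X \<A> c'" "p \<in> chart_dom c'" "chart_dom c' \<subseteq> W"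
    using small_foliated_chart[OF atlas_foliated_chart _ assms p] by blast
  then show "\<exists>V. openin (leaf_topology X \<A>) V \<and> p \<in> V \<and> V \<subseteq> W"
    using openin_leaf_plaque plaque_at_self
    by (intro exI[of _ "plaque_at c' p"]) (auto simp: plaque_at_def)
qed

lemma continuous_map_leaf_topology:
  "continuous_map X Y f \<Longrightarrow> continuous_map (leaf_topology X \<A>) Y f"
  using openin_leaf_topology by (simp add: continuous_map_def topspace_leaf_topology)

text \<open>Near each point the transversal coordinate of another chart is a function of that of
  \<open>c\<close>, so it is locally constant along a plaque of \<open>c\<close>, and plaques of
  other charts trace relatively open sets on it. Through this map, connectedness and compactness in
  \<open>X\<close> of subsets of a plaque become those of the leaf topology.\<close>

lemma continuous_map_plaque_inclusion:
  assumes c: "foliated_chart X \<A> c" and p: "p \<in> chart_dom c"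
  shows "continuous_map (subtopology X (plaque_at c p)) (leaf_topology X \<A>) (\<lambda>x. x)"
  unfolding leaf_topology_def
proof (rule continuous_on_generated_topo)
  let ?S = "subtopology X (plaque_at c p)"
  fix Q assume "Q \<in> \<Union> (plaques ` {c. foliated_chart X \<A> c})"
  then obtain b where b: "foliated_chart X \<A> b" "Q \<in> plaques b" by auto
  show "openin ?S ((\<lambda>x. x) -` Q \<inter> topspace ?S)"
  proof (subst openin_subopen, intro ballI)
    fix x assume "x \<in> (\<lambda>x. x) -` Q \<inter> topspace ?S"
    then have x: "x \<in> Q" "x \<in> plaque_at c p" by auto
    then have Q: "x \<in> chart_dom b" "Q = plaque_at b x"
      using b plaques_eq[OF foliated_chart_is_chart[OF b(1)]] plaque_at_eq by (auto simp: plaque_at_def)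
    have xc: "x \<in> chart_dom c" using x by (simp add: plaque_at_def)
    obtain W h where W: "openin X W" "x \<in> W" "W \<subseteq> chart_dom c \<inter> chart_dom b"
      "\<And>q. q \<in> W \<Longrightarrow> snd (chart_map b q) = h (snd (chart_map c q))"
      using transversal_change[OF c b(1) xc Q(1)] by blast
    have "W \<inter> plaque_at c p \<subseteq> Q"
      using W x(2) unfolding Q(2) plaque_at_def by auto
    moreover have "W \<inter> plaque_at c p \<subseteq> topspace ?S" using W(1) openin_subset by auto
    moreover have "openin ?S (W \<inter> plaque_at c p)" using W(1) by (auto simp: openin_subtopology)
    ultimately show "\<exists>T. openin ?S T \<and> x \<in> T \<and> T \<subseteq> (\<lambda>x. x) -` Q \<inter> topspace ?S"
      using W(2) x(2) by (intro exI[of _ "W \<inter> plaque_at c p"]) auto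
  qed
next
  have "(\<lambda>x. x) ` topspace (subtopology X (plaque_at c p)) \<subseteq> topspace (leaf_topology X \<A>)"
    by (auto simp: topspace_leaf_topology)
  then show "(\<lambda>x. x) ` topspace (subtopology X (plaque_at c p)) \<subseteq> \<Union> (\<Union> (plaques ` {c. foliated_chart X \<A> c}))"
    by (simp add: leaf_topology_def)
qed

lemma connectedin_leaf_plaque:
  assumes "foliated_chart X \<A> c" "p \<in> chart_dom c"
  shows "connectedin (leaf_topology X \<A>) (plaque_at c p)"
proof -
  have "connectedin (subtopology X (plaque_at c p)) (plaque_at c p)"
    using connectedin_plaque[OF foliated_chart_is_chart] assms by (simp add: connectedin_subtopology)
  then show ?thesis
    using connectedin_continuous_map_image[OF continuous_map_plaque_inclusion[OF assms]] by fastforce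
qed

lemma compactin_leaf_plaque:
  assumes "foliated_chart X \<A> c" "p \<in> chart_dom c" "compactin X K" "K \<subseteq> plaque_at c p"
  shows "compactin (leaf_topology X \<A>) K"
proof -
  have "compactin (subtopology X (plaque_at c p)) K"
    using assms by (simp add: compactin_subtopology)
  then show ?thesis
    using image_compactin[OF _ continuous_map_plaque_inclusion[OF assms(1,2)]] by fastforce
qed

lemma leaf_plaque_subset:
  assumes "M \<in> leaves X \<A>" "foliated_chart X \<A> c" "p \<in> chart_dom c" "x \<in> M" "x \<in> plaque_at c p"
  shows "plaque_at c p \<subseteq> M"
  using assms connectedin_leaf_plaque[OF assms(2,3)]
  by (intro connected_components_of_maximal[of M "leaf_topology X \<A>"]) (auto simp: leaves_def disjnt_iff)

lemma leaf_subset: "M \<in> leaves X \<A> \<Longrightarrow> M \<subseteq> topspace X"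
  using connected_components_of_subset topspace_leaf_topology by (fastforce simp: leaves_def)

lemma leaf_nonempty: "M \<in> leaves X \<A> \<Longrightarrow> M \<noteq> {}"
  by (metis leaves_def nonempty_connected_components_of)

end

section \<open>The plaque distance of a regular atlas\<close>

text \<open>Chains of plaques are replaced by powers of this relation. Its \<open>k\<close>-th power
  turns out to be distance at most \<open>k\<close> on a leaf, so symmetry, the triangle inequality
  and saturations become statements about relations.\<close>

definition plaque_adj :: "('a, 'n::finite, 'z) chart set \<Rightarrow> ('a \<times> 'a) set" where
  "plaque_adj \<U> = {(x, y). \<exists>c\<in>\<U>. x \<in> chart_dom c \<and> y \<in> plaque_at c x}"

lemma plaque_adj_sym: "(x, y) \<in> plaque_adj \<U> \<Longrightarrow> (y, x) \<in> plaque_adj \<U>"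
  by (auto simp: plaque_adj_def plaque_at_def)

lemma relpow_sym:
  assumes "\<And>x y. (x, y) \<in> R \<Longrightarrow> (y, x) \<in> R"
  shows "(x, y) \<in> R ^^ k \<Longrightarrow> (y, x) \<in> R ^^ k"
  by (induction k arbitrary: y) (auto simp del: relpow.simps(2) intro: assms relpow_Suc_I2 elim!: relpow_Suc_E)

locale regular_foliation = foliation X \<A> for X :: "'a topology" and \<A> :: "('a, 'n::finite, 'z) chart set" +
  fixes \<U> :: "('a, 'n, 'z) chart set"
  assumes compact: "compact_space X" and Hausdorff: "Hausdorff_space X"
    and regular: "regular_foliated_atlas X \<A> \<U>"
begin

abbreviation "E \<equiv> plaque_adj \<U>"

lemma regular_foliated_chart: "c \<in> \<U> \<Longrightarrow> foliated_chart X \<A> c"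
  using regular by (simp add: regular_foliated_atlas_def)

lemma regular_is_chart: "c \<in> \<U> \<Longrightarrow> is_chart X c"
  by (simp add: foliated_chart_is_chart regular_foliated_chart)

lemma regular_cover:
  assumes "p \<in> topspace X"
  obtains c where "c \<in> \<U>" "p \<in> chart_dom c"
proof -
  have "foliated_atlas X \<U>" using regular by (simp add: regular_foliated_atlas_def)
  then have "topspace X = \<Union> (chart_dom ` \<U>)" by (simp add: foliated_atlas_def)
  with assms obtain c where "c \<in> \<U>" "p \<in> chart_dom c" by blast
  then show thesis by (rule that)
qed

lemma plaque_adj_refl: "x \<in> topspace X \<Longrightarrow> (x, x) \<in> E"
  by (rule regular_cover) (auto simp: plaque_adj_def plaque_at_self)

lemma plaque_adj_topspace:
  assumes "(x, y) \<in> E"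
  shows "x \<in> topspace X" "y \<in> topspace X"
  using assms chart_dom_subset[OF regular_is_chart] by (auto simp: plaque_adj_def plaque_at_def)

lemma relpow_adj_topspace: "(x, y) \<in> E ^^ k \<Longrightarrow> x \<in> topspace X \<Longrightarrow> y \<in> topspace X"
  by (induction k arbitrary: y) (auto dest: plaque_adj_topspace)

lemma relpow_adj_mono:
  assumes "(x, y) \<in> E ^^ j" "j \<le> k" "x \<in> topspace X"
  shows "(x, y) \<in> E ^^ k"
  using assms(2)
proof (induction k rule: dec_induct)
  case base
  then show ?case by fact
next
  case (step m)
  then show ?case using plaque_adj_refl relpow_adj_topspace assms(3) by (blast intro: relpow_Suc_I)
qed

lemma relpow_adj_sym: "(x, y) \<in> E ^^ k \<Longrightarrow> (y, x) \<in> E ^^ k"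
  by (rule relpow_sym[OF plaque_adj_sym])

lemma adj_leaf:
  assumes "M \<in> leaves X \<A>" "x \<in> M" "(x, y) \<in> E"
  shows "y \<in> M"
proof -
  obtain c where "c \<in> \<U>" "x \<in> chart_dom c" "y \<in> plaque_at c x"
    using assms(3) by (auto simp: plaque_adj_def)
  then show ?thesis
    using leaf_plaque_subset[OF assms(1) regular_foliated_chart _ assms(2) plaque_at_self] by blast
qed

lemma relpow_adj_leaf:
  assumes "M \<in> leaves X \<A>" "x \<in> M"
  shows "(x, y) \<in> E ^^ k \<Longrightarrow> y \<in> M"
  by (induction k arbitrary: y) (use assms in \<open>auto dest: adj_leaf\<close>)

lemma openin_leaf_adj_closed:
  assumes "S \<subseteq> topspace X" "\<And>x y. x \<in> S \<Longrightarrow> (x, y) \<in> E \<Longrightarrow> y \<in> S"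
  shows "openin (leaf_topology X \<A>) S"
proof (subst openin_subopen, intro ballI)
  fix x assume x: "x \<in> S"
  then obtain c where c: "c \<in> \<U>" "x \<in> chart_dom c" using assms(1) regular_cover by blast
  then have "plaque_at c x \<subseteq> S" using x assms(2) unfolding plaque_adj_def by blast
  then show "\<exists>T. openin (leaf_topology X \<A>) T \<and> x \<in> T \<and> T \<subseteq> S"
    using openin_leaf_plaque[OF regular_foliated_chart[OF c(1)] c(2)] plaque_at_self[OF c(2)] by blast
qed

text \<open>The points reached from \<open>x\<close> and the remaining points of \<open>X\<close>
  are both unions of plaques, hence both open for the leaf topology, and a leaf is
  connected.\<close>

lemma leaf_chain_connected:
  assumes M: "M \<in> leaves X \<A>" and x: "x \<in> M" and y: "y \<in> M"
  obtains k where "(x, y) \<in> E ^^ k"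
proof -
  define S where "S = E\<^sup>* `` {x}"
  have xX: "x \<in> topspace X" using M x leaf_subset by blast
  have S_eq: "z \<in> S \<longleftrightarrow> (\<exists>k. (x, z) \<in> E ^^ k)" for z
    by (auto simp: S_def rtrancl_power)
  have "S \<subseteq> topspace X" using S_eq relpow_adj_topspace xX by blast
  moreover have S_closed: "z' \<in> S" if "z \<in> S" "(z, z') \<in> E" for z z'
    using that by (auto simp: S_def)
  ultimately have 1: "openin (leaf_topology X \<A>) S" by (rule openin_leaf_adj_closed)
  have 2: "openin (leaf_topology X \<A>) (topspace X - S)"
  proof (rule openin_leaf_adj_closed)
    fix z z' assume "z \<in> topspace X - S" "(z, z') \<in> E"
    then show "z' \<in> topspace X - S" using S_closed[of z' z] plaque_adj_sym plaque_adj_topspace(2) by fast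
  qed simp
  have "connectedin (leaf_topology X \<A>) M"
    using M by (simp add: leaves_def connectedin_connected_components_of)
  then have "\<not> (M \<subseteq> S \<union> (topspace X - S) \<and> S \<inter> (topspace X - S) \<inter> M = {} \<and> S \<inter> M \<noteq> {} \<and> (topspace X - S) \<inter> M \<noteq> {})"
    using 1 2 unfolding connectedin by blast
  moreover have "x \<in> S" by (simp add: S_def)
  ultimately have "M \<subseteq> S" using leaf_subset[OF M] x by blast
  then show thesis using that y S_eq by blast
qed

definition plaque_chain :: "'a \<Rightarrow> 'a \<Rightarrow> nat \<Rightarrow> bool" where
  "plaque_chain x y k \<longleftrightarrow> (\<exists>\<P>. \<P> \<subseteq> \<Union> (plaques ` \<U>) \<and> finite \<P> \<and> card \<P> = k \<and>
             connectedin (leaf_topology X \<A>) (\<Union>\<P>) \<and> x \<in> \<Union>\<P> \<and> y \<in> \<Union>\<P>)"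

text \<open>Steps may revisit a plaque that the family counts only once, whence the inequality. The
  statement starts at one step because the empty family covers no point.\<close>

lemma plaque_chain_of_relpow:
  "(x, y) \<in> E ^^ Suc k \<Longrightarrow> \<exists>j\<le>Suc k. plaque_chain x y j"
proof (induction k arbitrary: y)
  case 0
  then obtain c where c: "c \<in> \<U>" "x \<in> chart_dom c" "y \<in> plaque_at c x"
    by (auto simp: plaque_adj_def)
  then have "plaque_at c x \<in> \<Union> (plaques ` \<U>)" using plaques_eq[OF regular_is_chart] by blast
  then have "plaque_chain x y 1"
    unfolding plaque_chain_def
    using c plaque_at_self connectedin_leaf_plaque[OF regular_foliated_chart]
    by (intro exI[of _ "{plaque_at c x}"]) auto
  then show ?case by auto
next
  case (Suc k)
  then obtain z where z: "(x, z) \<in> E ^^ Suc k" "(z, y) \<in> E" by (auto elim: relpow_Suc_E)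
  then obtain j where "j \<le> Suc k" "plaque_chain x z j" using Suc.IH by blast
  then obtain \<P> where P: "\<P> \<subseteq> \<Union> (plaques ` \<U>)" "finite \<P>" "card \<P> \<le> Suc k"
    "connectedin (leaf_topology X \<A>) (\<Union>\<P>)" "x \<in> \<Union>\<P>" "z \<in> \<Union>\<P>"
    unfolding plaque_chain_def by auto
  obtain c where c: "c \<in> \<U>" "z \<in> chart_dom c" "y \<in> plaque_at c z"
    using z(2) by (auto simp: plaque_adj_def)
  define Q where "Q = plaque_at c z"
  have Q: "Q \<in> \<Union> (plaques ` \<U>)" "connectedin (leaf_topology X \<A>) Q" "z \<in> Q" "y \<in> Q"
    unfolding Q_def
    using c(1,3) imageI[OF c(2), of "plaque_at c"] plaques_eq[OF regular_is_chart[OF c(1)]]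
      connectedin_leaf_plaque[OF regular_foliated_chart[OF c(1)] c(2)] plaque_at_self[OF c(2)] by auto
  have "connectedin (leaf_topology X \<A>) (Q \<union> \<Union>\<P>)"
    using Q(2,3) P(4,6) by (intro connectedin_Un) auto
  then have "plaque_chain x y (card (insert Q \<P>))"
    unfolding plaque_chain_def using P Q by (intro exI[of _ "insert Q \<P>"]) auto
  moreover have "card (insert Q \<P>) \<le> Suc (Suc k)"
    using P(2,3) by (simp add: card_insert_if)
  ultimately show ?case by blast
qed

text \<open>A connected union of \<open>k\<close> plaques is exhausted from any of its points by adding, one at a time,
  a plaque that meets the previous ones.\<close>

lemma relpow_of_plaque_chain:
  assumes "plaque_chain x y k"
  shows "(x, y) \<in> E ^^ k"
proof -
  obtain \<P> where P: "\<P> \<subseteq> \<Union> (plaques ` \<U>)" "finite \<P>" "card \<P> = k"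
    "connectedin (leaf_topology X \<A>) (\<Union>\<P>)" "x \<in> \<Union>\<P>" "y \<in> \<Union>\<P>"
    using assms unfolding plaque_chain_def by blast
  have plaque: "\<exists>c\<in>\<U>. \<exists>p\<in>chart_dom c. P = plaque_at c p" if "P \<in> \<P>" for P
    using that P(1) plaques_eq[OF regular_is_chart] by blast
  have adj: "(p, q) \<in> E" if "Q \<in> \<P>" "p \<in> Q" "q \<in> Q" for p q Q
    using plaque[OF that(1)] that(2,3) by (auto simp: plaque_adj_def plaque_at_def)
  have op: "openin (leaf_topology X \<A>) (\<Union>\<Q>)" if "\<Q> \<subseteq> \<P>" for \<Q>
  proof (rule openin_Union)
    fix P assume "P \<in> \<Q>"
    with that obtain c p where "c \<in> \<U>" "p \<in> chart_dom c" "P = plaque_at c p" using plaque by blast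
    then show "openin (leaf_topology X \<A>) P" by (simp add: openin_leaf_plaque regular_foliated_chart)
  qed
  \<comment> \<open>Ensures that the union of the plaques not yet taken has a point, as the
    separation argument requires.\<close>
  have ne: "Q \<noteq> {}" if Q: "Q \<in> \<P>" for Q
  proof -
    from plaque[OF Q] obtain c p where "c \<in> \<U>" "p \<in> chart_dom c" "Q = plaque_at c p" by (elim bexE)
    then show ?thesis using plaque_at_self[of p c] by auto
  qed
  obtain P0 where P0: "P0 \<in> \<P>" "x \<in> P0" using P(5) by blast
  have grow: "\<exists>\<Q>\<subseteq>\<P>. card \<Q> = j \<and> P0 \<in> \<Q> \<and> (\<forall>q\<in>\<Union>\<Q>. (x, q) \<in> E ^^ j)" if "1 \<le> j" "j \<le> k" for j
    using that
  proof (induction j rule: dec_induct)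
    case base
    show ?case using P0 adj by (intro exI[of _ "{P0}"]) auto
  next
    case (step j)
    then obtain \<Q> where Q: "\<Q> \<subseteq> \<P>" "card \<Q> = j" "P0 \<in> \<Q>" "\<And>q. q \<in> \<Union>\<Q> \<Longrightarrow> (x, q) \<in> E ^^ j"
      by auto
    have "\<Q> \<noteq> \<P>" using Q(2) P(3) step.prems by auto
    \<comment> \<open>Both unions are open and nonempty and cover the connected set, so they
      overlap; the overlap supplies the next plaque \<open>R\<close>.\<close>
    have "\<Union>\<Q> \<inter> \<Union>(\<P> - \<Q>) \<inter> \<Union>\<P> \<noteq> {}"
    proof
      assume "\<Union>\<Q> \<inter> \<Union>(\<P> - \<Q>) \<inter> \<Union>\<P> = {}"
      moreover have "\<Union>\<P> \<subseteq> \<Union>\<Q> \<union> \<Union>(\<P> - \<Q>)" by blast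
      moreover have "\<Union>\<Q> \<inter> \<Union>\<P> \<noteq> {}" using Q(3) P0 by blast
      moreover have "\<Union>(\<P> - \<Q>) \<inter> \<Union>\<P> \<noteq> {}"
      proof -
        obtain R where "R \<in> \<P> - \<Q>" using \<open>\<Q> \<noteq> \<P>\<close> Q(1) by blast
        then show ?thesis using ne by blast
      qed
      ultimately show False
        using P(4) op[OF Q(1)] op[of "\<P> - \<Q>"] unfolding connectedin by blast
    qed
    then obtain R r where R: "R \<in> \<P>" "R \<notin> \<Q>" "r \<in> R" "r \<in> \<Union>\<Q>" by blast
    have "(x, q) \<in> E ^^ Suc j" if "q \<in> \<Union>(insert R \<Q>)" for q
    proof (cases "q \<in> R")
      case True
      then show ?thesis using Q(4)[OF R(4)] adj[OF R(1,3)] by (blast intro: relpow_Suc_I)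
    next
      case False
      then have q: "q \<in> \<Union>\<Q>" using that by blast
      moreover have "(q, q) \<in> E" using q Q(1) adj by blast
      ultimately show ?thesis using Q(4) by (blast intro: relpow_Suc_I)
    qed
    moreover have "card (insert R \<Q>) = Suc j"
      using Q(1,2) R(2) finite_subset[OF _ P(2)] by auto
    ultimately show ?case using Q R by (intro exI[of _ "insert R \<Q>"]) auto
  qed
  have "1 \<le> k" using P0(1) P(2,3) by (metis One_nat_def Suc_leI card_gt_0_iff empty_iff)
  from grow[OF this order_refl] obtain \<Q>
    where Q: "\<Q> \<subseteq> \<P>" "card \<Q> = k" "\<forall>q\<in>\<Union>\<Q>. (x, q) \<in> E ^^ k" by (elim exE conjE)
  then have "\<Q> = \<P>" using P(2,3) by (simp add: card_subset_eq)
  with Q(3) P(6) show ?thesis by (simp only:)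
qed

text \<open>Points of one leaf are always joined by a chain, so \<open>LEAST\<close> is attained;
  reflexivity of adjacency then fills a short chain up to length \<open>k\<close>.\<close>

lemma plaque_dist_le_iff:
  assumes M: "M \<in> leaves X \<A>" and x: "x \<in> M" and y: "y \<in> M"
  shows "plaque_dist X \<A> \<U> x y \<le> k \<longleftrightarrow> (x, y) \<in> E ^^ k"
proof (cases "x = y")
  case True
  have "x \<in> topspace X" using M x leaf_subset by blast
  then have "(x, y) \<in> E ^^ k" using True relpow_adj_mono[of x y 0 k] by simp
  then show ?thesis using True by (simp add: plaque_dist_def)
next
  case False
  have xX: "x \<in> topspace X" using M x leaf_subset by blast
  have dist: "plaque_dist X \<A> \<U> x y = (LEAST k. plaque_chain x y k)"
    using False by (simp add: plaque_dist_def plaque_chain_def)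
  have chain: "\<exists>j\<le>m. plaque_chain x y j" if "(x, y) \<in> E ^^ m" for m
  proof (cases m)
    case 0
    then show ?thesis using that False by simp
  next
    case (Suc i)
    then show ?thesis using that plaque_chain_of_relpow by blast
  qed
  obtain m where "(x, y) \<in> E ^^ m" using leaf_chain_connected[OF M x y] by blast
  then obtain j where "plaque_chain x y j" using chain by blast
  then have least: "plaque_chain x y (LEAST k. plaque_chain x y k)" by (rule LeastI)
  show ?thesis
  proof
    assume "plaque_dist X \<A> \<U> x y \<le> k"
    then show "(x, y) \<in> E ^^ k"
      using relpow_of_plaque_chain[OF least] relpow_adj_mono[OF _ _ xX] dist by simp
  next
    assume "(x, y) \<in> E ^^ k"
    then obtain j where "j \<le> k" "plaque_chain x y j" using chain by blast
    then show "plaque_dist X \<A> \<U> x y \<le> k" using dist Least_le[of "plaque_chain x y" j] by linarith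
  qed
qed

text \<open>In one chart, the points on plaques meeting \<open>W\<close> form the preimage of the
  image of \<open>W\<close> in the transversal, and that image is open because the projection is an
  open map.\<close>

lemma openin_adj_Image:
  assumes W: "openin X W"
  shows "openin X (E `` W)"
proof -
  have eq: "E `` W = (\<Union>c\<in>\<U>. {x \<in> topspace (subtopology X (chart_dom c)).
      snd (chart_map c x) \<in> (\<lambda>p. snd (chart_map c p)) ` (W \<inter> chart_dom c)})"
    using chart_dom_subset[OF regular_is_chart] by (fastforce simp: plaque_adj_def plaque_at_def)
  have "openin X {x \<in> topspace (subtopology X (chart_dom c)).
      snd (chart_map c x) \<in> (\<lambda>p. snd (chart_map c p)) ` (W \<inter> chart_dom c)}" if "c \<in> \<U>" for c
  proof (rule openin_trans_full)
    show "openin X (chart_dom c)" using chart_dom_openin[OF regular_is_chart[OF that]] .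
    show "openin (subtopology X (chart_dom c)) {x \<in> topspace (subtopology X (chart_dom c)).
      snd (chart_map c x) \<in> (\<lambda>p. snd (chart_map c p)) ` (W \<inter> chart_dom c)}"
      using continuous_map_transversal[OF regular_is_chart[OF that]]
        openin_transversal_image[OF regular_is_chart[OF that] W]
      by (rule openin_continuous_map_preimage)
  qed
  then show ?thesis unfolding eq by (intro openin_Union) auto
qed

lemma openin_relpow_adj_Image:
  assumes "openin X W"
  shows "openin X ((E ^^ k) `` W)"
  by (induction k) (use assms in \<open>auto simp: relcomp_Image intro: openin_adj_Image\<close>)

text \<open>Local finiteness combined with compactness of \<open>X\<close>. Local finiteness does
  not count charts with empty domain, so these are left out.\<close>

lemma finite_nonempty_charts: "finite {c \<in> \<U>. chart_dom c \<noteq> {}}"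
proof -
  have "\<forall>p\<in>topspace X. \<exists>W. openin X W \<and> p \<in> W \<and> finite {c\<in>\<U>. chart_dom c \<inter> W \<noteq> {}}"
    using regular unfolding regular_foliated_atlas_def by (elim conjE)
  from bchoice[OF this] obtain W
    where W: "\<forall>p\<in>topspace X. openin X (W p) \<and> p \<in> W p \<and> finite {c\<in>\<U>. chart_dom c \<inter> W p \<noteq> {}}" ..
  have "compactin X (topspace X)" using compact by (simp add: compact_space_def)
  then have "\<exists>\<F>. finite \<F> \<and> \<F> \<subseteq> W ` topspace X \<and> topspace X \<subseteq> \<Union>\<F>"
    by (rule compactinD) (use W in auto)
  then obtain F where F: "finite F" "F \<subseteq> topspace X" "topspace X \<subseteq> \<Union>(W ` F)"
    by (metis finite_subset_image)
  have "{c \<in> \<U>. chart_dom c \<noteq> {}} \<subseteq> (\<Union>p\<in>F. {c\<in>\<U>. chart_dom c \<inter> W p \<noteq> {}})"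
  proof
    fix c assume c: "c \<in> {c \<in> \<U>. chart_dom c \<noteq> {}}"
    then obtain x where "x \<in> chart_dom c" by blast
    moreover from this c have "x \<in> topspace X" using chart_dom_subset[OF regular_is_chart] by blast
    ultimately show "c \<in> (\<Union>p\<in>F. {c\<in>\<U>. chart_dom c \<inter> W p \<noteq> {}})" using F(3) c by blast
  qed
  moreover have "finite (\<Union>p\<in>F. {c\<in>\<U>. chart_dom c \<inter> W p \<noteq> {}})"
    using F W by (intro finite_UN_I) auto
  ultimately show ?thesis by (rule finite_subset)
qed

text \<open>By regularity \<open>P\<close> meets at most one plaque of each chart, and only finitely
  many charts have a nonempty domain.\<close>

lemma finite_meeting_plaques:
  assumes "P \<in> \<Union> (plaques ` \<U>)"
  shows "finite {Q \<in> \<Union> (plaques ` \<U>). P \<inter> Q \<noteq> {}}"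
proof -
  obtain c where c: "c \<in> \<U>" "P \<in> plaques c" using assms by blast
  have sub: "Q \<subseteq> X closure_of Q" if "d \<in> \<U>" "Q \<in> plaques d" for d Q
    using that chart_dom_subset[OF regular_is_chart[OF that(1)]]
    by (intro closure_of_subset) (auto simp: plaques_def)
  have uniq: "Q = Q'" if "d \<in> \<U>" "Q \<in> plaques d" "Q' \<in> plaques d" "P \<inter> Q \<noteq> {}" "P \<inter> Q' \<noteq> {}" for d Q Q'
  proof -
    have "X closure_of P \<inter> X closure_of Q \<noteq> {}" "X closure_of P \<inter> X closure_of Q' \<noteq> {}"
      using sub[OF c] sub[OF that(1,2)] sub[OF that(1,3)] that(4,5) by blast+
    moreover have "\<forall>c\<in>\<U>. \<forall>d\<in>\<U>. \<forall>P \<in> plaques c. \<forall>Q \<in> plaques d. \<forall>Q' \<in> plaques d.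
        X closure_of P \<inter> X closure_of Q \<noteq> {} \<and> X closure_of P \<inter> X closure_of Q' \<noteq> {} \<longrightarrow> Q = Q'"
      using regular unfolding regular_foliated_atlas_def by (elim conjE)
    ultimately show ?thesis using c that(1-3) by blast
  qed
  have "finite {Q \<in> plaques d. P \<inter> Q \<noteq> {}}" if "d \<in> \<U>" for d
  proof (cases "\<exists>Q. Q \<in> plaques d \<and> P \<inter> Q \<noteq> {}")
    case True
    then obtain Q where "Q \<in> plaques d" "P \<inter> Q \<noteq> {}" by blast
    then have "{Q \<in> plaques d. P \<inter> Q \<noteq> {}} \<subseteq> {Q}" using uniq[OF that] by blast
    then show ?thesis by (rule finite_subset) simp
  next
    case False
    then have "{Q \<in> plaques d. P \<inter> Q \<noteq> {}} = {}" by blast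
    then show ?thesis by (simp only: finite.emptyI)
  qed
  moreover have "{Q \<in> \<Union> (plaques ` \<U>). P \<inter> Q \<noteq> {}} \<subseteq>
      (\<Union>d\<in>{d \<in> \<U>. chart_dom d \<noteq> {}}. {Q \<in> plaques d. P \<inter> Q \<noteq> {}})"
    by (auto simp: plaques_def)
  moreover from calculation(1) have "finite (\<Union>d\<in>{d \<in> \<U>. chart_dom d \<noteq> {}}. {Q \<in> plaques d. P \<inter> Q \<noteq> {}})"
    using finite_nonempty_charts by (intro finite_UN_I) simp_all
  ultimately show ?thesis by (blast intro: finite_subset)
qed

text \<open>Each further step leads from a plaque of the finite family to a plaque meeting it, and
  there are finitely many of those.\<close>

lemma finite_plaque_cover_ball:
  assumes x: "x \<in> topspace X"
  shows "\<exists>\<Q>. finite \<Q> \<and> \<Q> \<subseteq> \<Union> (plaques ` \<U>) \<and> (E ^^ k) `` {x} \<subseteq> \<Union>\<Q>"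
proof (induction k)
  case 0
  obtain c where c: "c \<in> \<U>" "x \<in> chart_dom c" using regular_cover[OF x] by blast
  then have "plaque_at c x \<in> \<Union> (plaques ` \<U>)" using plaques_eq[OF regular_is_chart] by blast
  then show ?case using plaque_at_self[OF c(2)] by (intro exI[of _ "{plaque_at c x}"]) auto
next
  case (Suc k)
  then obtain \<Q> where Q: "finite \<Q>" "\<Q> \<subseteq> \<Union> (plaques ` \<U>)" "(E ^^ k) `` {x} \<subseteq> \<Union>\<Q>" by blast
  define \<Q>' where "\<Q>' = (\<Union>P\<in>\<Q>. {Q \<in> \<Union> (plaques ` \<U>). P \<inter> Q \<noteq> {}})"
  have "finite \<Q>'" unfolding \<Q>'_def using Q finite_meeting_plaques by (intro finite_UN_I) blast+
  moreover have "\<Q>' \<subseteq> \<Union> (plaques ` \<U>)" unfolding \<Q>'_def by blast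
  moreover have "z \<in> \<Union>\<Q>'" if z: "z \<in> (E ^^ Suc k) `` {x}" for z
  proof -
    obtain y where y: "(x, y) \<in> E ^^ k" "(y, z) \<in> E" using z by auto
    then obtain P where P: "P \<in> \<Q>" "y \<in> P" using Q(3) by blast
    obtain c where c: "c \<in> \<U>" "y \<in> chart_dom c" "z \<in> plaque_at c y"
      using y(2) by (auto simp: plaque_adj_def)
    then have "plaque_at c y \<in> \<Union> (plaques ` \<U>)" using plaques_eq[OF regular_is_chart] by blast
    moreover have "P \<inter> plaque_at c y \<noteq> {}" using P(2) plaque_at_self[OF c(2)] by blast
    ultimately have "plaque_at c y \<in> \<Q>'" unfolding \<Q>'_def using P(1) by blast
    then show ?thesis using c(3) by blast
  qed
  ultimately show ?case by blast
qed

text \<open>Fixing one witness of regularity for each chart provides a transversal coordinate on the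
  closure of its domain.\<close>

definition enlarged :: "('a, 'n, 'z) chart \<Rightarrow> ('a, 'n, 'z) chart" where
  "enlarged c = (SOME c'. foliated_chart X \<A> c' \<and> chart_restriction c c' \<and>
     X closure_of chart_dom c \<subseteq> chart_dom c')"

lemma enlarged:
  assumes "c \<in> \<U>"
  shows "foliated_chart X \<A> (enlarged c)" "X closure_of chart_dom c \<subseteq> chart_dom (enlarged c)"
    "\<And>p. p \<in> chart_dom c \<Longrightarrow> chart_map (enlarged c) p = chart_map c p"
proof -
  have "\<forall>c\<in>\<U>. \<exists>c'. foliated_chart X \<A> c' \<and> chart_restriction c c' \<and>
      X closure_of chart_dom c \<subseteq> chart_dom c'"
    using regular unfolding regular_foliated_atlas_def by (elim conjE)
  from bspec[OF this assms]
  have "\<exists>c'. foliated_chart X \<A> c' \<and> chart_restriction c c' \<and> X closure_of chart_dom c \<subseteq> chart_dom c'" .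
  then have "foliated_chart X \<A> (enlarged c) \<and> chart_restriction c (enlarged c) \<and>
     X closure_of chart_dom c \<subseteq> chart_dom (enlarged c)"
    unfolding enlarged_def by (rule someI_ex)
  then show "foliated_chart X \<A> (enlarged c)" "X closure_of chart_dom c \<subseteq> chart_dom (enlarged c)"
    "\<And>p. p \<in> chart_dom c \<Longrightarrow> chart_map (enlarged c) p = chart_map c p"
    by (auto simp: chart_restriction_def)
qed

section \<open>Closed chains and relatively compact balls\<close>

lemma chart_dom_closure: "c \<in> \<U> \<Longrightarrow> chart_dom c \<subseteq> X closure_of chart_dom c"
  by (simp add: closure_of_subset chart_dom_subset regular_is_chart)

text \<open>Plaque adjacency is not closed. Passing to the closures of the domains, inside enlarged charts,
  repairs this without leaving the leaves, so a leaf disjoint from a closed set has a neighbourhood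
  whose points are not joined to that set by chains of a given length.\<close>

definition closed_adj :: "('a \<times> 'a) set" where
  "closed_adj = {(x, y). \<exists>c\<in>\<U>. x \<in> X closure_of chart_dom c \<and> y \<in> X closure_of chart_dom c \<and>
     snd (chart_map (enlarged c) x) = snd (chart_map (enlarged c) y)}"

lemma plaque_adj_closed_adj: "E \<subseteq> closed_adj"
  using chart_dom_closure enlarged(3) by (fastforce simp: plaque_adj_def closed_adj_def plaque_at_def)

lemma closed_adj_leaf:
  assumes "M \<in> leaves X \<A>" "x \<in> M" "(x, y) \<in> closed_adj"
  shows "y \<in> M"
proof -
  obtain c where c: "c \<in> \<U>" "x \<in> X closure_of chart_dom c" "y \<in> X closure_of chart_dom c"
     "snd (chart_map (enlarged c) x) = snd (chart_map (enlarged c) y)"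
    using assms(3) by (auto simp: closed_adj_def)
  have x: "x \<in> chart_dom (enlarged c)" and "y \<in> chart_dom (enlarged c)"
    using c enlarged(2)[OF c(1)] by auto
  with c(4) have "y \<in> plaque_at (enlarged c) x" by (simp add: plaque_at_def)
  then show ?thesis
    using leaf_plaque_subset[OF assms(1) enlarged(1)[OF c(1)] x assms(2) plaque_at_self[OF x]] by blast
qed

lemma relpow_closed_adj_leaf:
  assumes "M \<in> leaves X \<A>" "x \<in> M"
  shows "(x, y) \<in> closed_adj ^^ k \<Longrightarrow> y \<in> M"
  by (induction k arbitrary: y) (use assms in \<open>auto dest: closed_adj_leaf\<close>)

text \<open>For one chart, the compact set \<open>C \<inter> X closure_of chart_dom c\<close> has a
  compact, hence closed, image in the Hausdorff transversal of the enlarged chart. The preimage is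
  closed only relative to the enlarged domain; intersecting it with the closure of the smaller
  domain makes it closed in \<open>X\<close>. Finitely many charts are involved.\<close>

lemma closedin_closed_adj_Image:
  assumes C: "closedin X C"
  shows "closedin X (closed_adj `` C)"
proof -
  define t where "t c = (\<lambda>p. snd (chart_map (enlarged c) p))" for c
  define A where "A c = {x \<in> X closure_of chart_dom c. t c x \<in> t c ` (C \<inter> X closure_of chart_dom c)}" for c
  have eq: "closed_adj `` C = \<Union>(A ` {c \<in> \<U>. chart_dom c \<noteq> {}})"
  proof (intro equalityI subsetI)
    fix y assume "y \<in> closed_adj `` C"
    then obtain x c where xc: "x \<in> C" "c \<in> \<U>" "x \<in> X closure_of chart_dom c" "y \<in> X closure_of chart_dom c"
     "t c x = t c y"
      by (auto simp: closed_adj_def t_def)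
    then have "t c y \<in> t c ` (C \<inter> X closure_of chart_dom c)" by (intro image_eqI[of _ _ x]) auto
    then have "y \<in> A c" using xc(4) by (simp add: A_def)
    moreover have "chart_dom c \<noteq> {}" using xc(3) by (metis closure_of_empty empty_iff)
    ultimately show "y \<in> \<Union>(A ` {c \<in> \<U>. chart_dom c \<noteq> {}})" using xc(2) by blast
  next
    fix y assume "y \<in> \<Union>(A ` {c \<in> \<U>. chart_dom c \<noteq> {}})"
    then obtain x c where "x \<in> C" "c \<in> \<U>" "x \<in> X closure_of chart_dom c" "y \<in> X closure_of chart_dom c"
     "t c x = t c y"
      unfolding A_def by force
    then show "y \<in> closed_adj `` C" by (auto simp: closed_adj_def t_def)
  qed
  have "closedin X (A c)" if c: "c \<in> \<U>" for c
  proof -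
    let ?D = "chart_dom (enlarged c)" and ?Z = "chart_trans (enlarged c)"
    have big: "is_chart X (enlarged c)" using enlarged(1)[OF c] foliated_chart_is_chart by blast
    have cont: "continuous_map (subtopology X ?D) ?Z (t c)"
      unfolding t_def by (rule continuous_map_transversal[OF big])
    have "compactin X (C \<inter> X closure_of chart_dom c)"
      using C compact by (intro closedin_compact_space closedin_Int) auto
    then have "compactin (subtopology X ?D) (C \<inter> X closure_of chart_dom c)"
      using enlarged(2)[OF c] by (auto simp: compactin_subtopology)
    then have "compactin ?Z (t c ` (C \<inter> X closure_of chart_dom c))"
      using cont by (rule image_compactin)
    then have "closedin ?Z (t c ` (C \<inter> X closure_of chart_dom c))"
      using chart_trans_Hausdorff[OF big] compactin_imp_closedin by blast
    then have "closedin (subtopology X ?D) {x \<in> topspace (subtopology X ?D). t c x \<in> t c ` (C \<inter> X closure_of chart_dom c)}"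
      using cont by (intro closedin_continuous_map_preimage)
    then obtain F where F: "closedin X F"
      "{x \<in> topspace (subtopology X ?D). t c x \<in> t c ` (C \<inter> X closure_of chart_dom c)} = F \<inter> ?D"
      by (auto simp: closedin_subtopology)
    have "A c = X closure_of chart_dom c \<inter> F"
    proof -
      have "A c = X closure_of chart_dom c \<inter> {x \<in> topspace (subtopology X ?D). t c x \<in> t c ` (C \<inter> X closure_of chart_dom c)}"
        using enlarged(2)[OF c] chart_dom_subset[OF big] unfolding A_def by auto
      also have "\<dots> = X closure_of chart_dom c \<inter> F"
        unfolding F(2) using enlarged(2)[OF c] by blast
      finally show ?thesis .
    qed
    then show ?thesis using F(1) by (simp add: closedin_Int)
  qed
  then show ?thesis unfolding eq using finite_nonempty_charts by (intro closedin_Union) auto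
qed

lemma closedin_relpow_closed_adj_Image:
  assumes "closedin X C"
  shows "closedin X ((closed_adj ^^ k) `` C)"
  by (induction k) (use assms in \<open>auto simp: relcomp_Image intro: closedin_closed_adj_Image\<close>)

text \<open>The closure of a plaque in \<open>X\<close> stays inside a single plaque of the enlarged
  chart, where compactness in \<open>X\<close> implies compactness for the leaf topology.\<close>

lemma plaque_compact_hull:
  assumes M: "M \<in> leaves X \<A>" and P: "P \<in> \<Union> (plaques ` \<U>)" "P \<inter> M \<noteq> {}"
  obtains K where "compactin (leaf_topology X \<A>) K" "K \<subseteq> M" "P \<subseteq> K"
proof -
  obtain c where c: "c \<in> \<U>" "P \<in> plaques c" using P by blast
  obtain p where p: "p \<in> chart_dom c" "P = plaque_at c p" using c plaques_eq[OF regular_is_chart] by blast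
  obtain x where x: "x \<in> P" "x \<in> M" using P by blast
  have big: "is_chart X (enlarged c)" using enlarged(1)[OF c(1)] foliated_chart_is_chart by blast
  have dom: "X closure_of chart_dom c \<subseteq> chart_dom (enlarged c)" using enlarged(2)[OF c(1)] .
  have pb: "p \<in> chart_dom (enlarged c)" using p dom chart_dom_closure[OF c(1)] by blast
  have P': "P \<subseteq> plaque_at (enlarged c) p"
    using p enlarged(3)[OF c(1)] dom chart_dom_closure[OF c(1)] by (auto simp: plaque_at_def)
  define K where "K = X closure_of P"
  have PK: "P \<subseteq> K"
    using p chart_dom_subset[OF regular_is_chart[OF c(1)]]
    unfolding K_def by (intro closure_of_subset) (auto simp: plaque_at_def)
  have Kc: "K \<subseteq> X closure_of chart_dom c"
    unfolding K_def using p by (intro closure_of_mono) (auto simp: plaque_at_def)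
  have KP: "K \<subseteq> plaque_at (enlarged c) p"
  proof -
    let ?D = "chart_dom (enlarged c)" and ?Z = "chart_trans (enlarged c)"
    have pZ: "snd (chart_map (enlarged c) p) \<in> topspace ?Z"
      using imageI[OF pb, of "chart_map (enlarged c)"] unfolding chart_map_image[OF big]
      by (simp add: mem_Times_iff)
    then have "closedin ?Z {snd (chart_map (enlarged c) p)}"
      using chart_trans_Hausdorff[OF big] by (simp add: closedin_Hausdorff_singleton)
    then have "closedin (subtopology X ?D) {q \<in> topspace (subtopology X ?D).
        snd (chart_map (enlarged c) q) \<in> {snd (chart_map (enlarged c) p)}}"
      using continuous_map_transversal[OF big] by (intro closedin_continuous_map_preimage)
    moreover have "{q \<in> topspace (subtopology X ?D).
        snd (chart_map (enlarged c) q) \<in> {snd (chart_map (enlarged c) p)}} = plaque_at (enlarged c) p"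
      using chart_dom_subset[OF big] by (auto simp: plaque_at_def)
    ultimately obtain F where F: "closedin X F" "plaque_at (enlarged c) p = F \<inter> ?D"
      by (auto simp: closedin_subtopology)
    then have "K \<subseteq> F" unfolding K_def using P' by (intro closure_of_minimal) auto
    then show ?thesis using F(2) Kc dom by blast
  qed
  have "compactin X K" unfolding K_def using compact by (simp add: closedin_compact_space)
  then have "compactin (leaf_topology X \<A>) K"
    using compactin_leaf_plaque[OF enlarged(1)[OF c(1)] pb] KP by blast
  moreover have "K \<subseteq> M"
    using KP leaf_plaque_subset[OF M enlarged(1)[OF c(1)] pb x(2)] P' x(1) by blast
  ultimately show thesis using that PK by blast
qed

lemma ball_compact_hull:
  assumes M: "M \<in> leaves X \<A>" and x: "x \<in> M"
  obtains K where "compactin (leaf_topology X \<A>) K" "K \<subseteq> M" "(E ^^ k) `` {x} \<subseteq> K"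
proof -
  have "x \<in> topspace X" using leaf_subset[OF M] x by blast
  from finite_plaque_cover_ball[OF this, of k] obtain \<Q>
    where Q: "finite \<Q>" "\<Q> \<subseteq> \<Union> (plaques ` \<U>)" "(E ^^ k) `` {x} \<subseteq> \<Union>\<Q>" by (elim exE conjE)
  define \<R> where "\<R> = {P \<in> \<Q>. P \<inter> M \<noteq> {}}"
  have "\<exists>K. compactin (leaf_topology X \<A>) K \<and> K \<subseteq> M \<and> P \<subseteq> K" if "P \<in> \<R>" for P
  proof -
    have "P \<in> \<Union> (plaques ` \<U>)" "P \<inter> M \<noteq> {}" using that Q(2) by (auto simp: \<R>_def)
    from plaque_compact_hull[OF M this] show ?thesis by metis
  qed
  then obtain K where K: "\<And>P. P \<in> \<R> \<Longrightarrow> compactin (leaf_topology X \<A>) (K P) \<and> K P \<subseteq> M \<and> P \<subseteq> K P"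
    by metis
  have "compactin (leaf_topology X \<A>) (\<Union>(K ` \<R>))"
    using K Q(1) unfolding \<R>_def by (intro compactin_Union) auto
  moreover have "\<Union>(K ` \<R>) \<subseteq> M" using K by blast
  moreover have "(E ^^ k) `` {x} \<subseteq> \<Union>(K ` \<R>)"
  proof
    fix y assume y: "y \<in> (E ^^ k) `` {x}"
    then have "y \<in> M" using relpow_adj_leaf[OF M x] by blast
    moreover obtain P where "P \<in> \<Q>" "y \<in> P" using y Q(3) by blast
    ultimately have "P \<in> \<R>" unfolding \<R>_def by blast
    then show "y \<in> \<Union>(K ` \<R>)" using K \<open>y \<in> P\<close> by blast
  qed
  ultimately show thesis by (rule that)
qed

text \<open>An unnormalised partition of unity on \<open>X\<close>; division by the sum is postponed
  to \<open>plaque_smoothing\<close>. Each cutoff is paired with a chart containing its nonzero set,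
  since one chart may carry several cutoffs.\<close>

lemma chart_cutoffs:
  obtains I :: "(('a, 'n, 'z) chart \<times> ('a \<Rightarrow> real)) set"
  where "finite I" "\<And>c u. (c, u) \<in> I \<Longrightarrow> c \<in> \<U> \<and> continuous_map X euclideanreal u"
    "\<And>c u x. (c, u) \<in> I \<Longrightarrow> x \<in> topspace X \<Longrightarrow> 0 \<le> u x"
    "\<And>c u x. (c, u) \<in> I \<Longrightarrow> x \<in> topspace X \<Longrightarrow> u x \<noteq> 0 \<Longrightarrow> x \<in> chart_dom c"
    "\<And>x. x \<in> topspace X \<Longrightarrow> \<exists>(c, u)\<in>I. 0 < u x"
proof -
  have creg: "completely_regular_space X"
    using compact Hausdorff
    by (intro normal_imp_completely_regular_space) (auto simp: compact_Hausdorff_or_regular_imp_normal_space)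
  define J where "J = {(c, u). c \<in> \<U> \<and> continuous_map X euclideanreal u \<and>
    (\<forall>x\<in>topspace X. 0 \<le> u x \<and> (u x \<noteq> 0 \<longrightarrow> x \<in> chart_dom c))}"
  define B where "B = (\<lambda>(c::('a, 'n, 'z) chart, u). {x \<in> topspace X. u x \<in> {0::real<..}})"
  have "openin X (B i)" if "i \<in> J" for i
    using that unfolding B_def J_def
    by (auto simp del: greaterThan_iff intro!: openin_continuous_map_preimage[where Y = euclideanreal])
  moreover have "topspace X \<subseteq> \<Union>(B ` J)"
  proof
    fix p assume p: "p \<in> topspace X"
    obtain c where c: "c \<in> \<U>" "p \<in> chart_dom c" by (rule regular_cover[OF p])
    have "closedin X (topspace X - chart_dom c)"
      using chart_dom_openin[OF regular_is_chart[OF c(1)]] by (simp add: closedin_diff)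
    then obtain f where f: "continuous_map X (top_of_set {0..1::real}) f" "f p = 0" "f ` (topspace X - chart_dom c) \<subseteq> {1}"
      using creg p c(2) unfolding completely_regular_space_def by blast
    have fc: "continuous_map X euclideanreal f" and fr: "\<And>x. x \<in> topspace X \<Longrightarrow> f x \<in> {0..1}"
      using f(1) by (auto simp: continuous_map_in_subtopology)
    have "(c, \<lambda>x. 1 - f x) \<in> J"
      unfolding J_def using c(1) fc fr f(3) by (auto intro!: continuous_map_diff)
    moreover have "p \<in> B (c, \<lambda>x. 1 - f x)" using p f(2) by (simp add: B_def)
    ultimately show "p \<in> \<Union>(B ` J)" by blast
  qed
  moreover have "compactin X (topspace X)" using compact by (simp add: compact_space_def)
  ultimately obtain \<F> where "finite \<F>" "\<F> \<subseteq> B ` J" "topspace X \<subseteq> \<Union>\<F>"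
    using compactinD[of X "topspace X" "B ` J"] by blast
  then obtain I where I: "finite I" "I \<subseteq> J" "topspace X \<subseteq> \<Union>(B ` I)" by (metis finite_subset_image)
  show thesis
  proof (rule that[OF I(1)])
    fix c u assume "(c, u) \<in> I"
    then have cu: "(c, u) \<in> J" using I(2) by blast
    show "c \<in> \<U> \<and> continuous_map X euclideanreal u" using cu by (simp add: J_def)
    show "0 \<le> u x" if "x \<in> topspace X" for x using cu that by (simp add: J_def)
    show "x \<in> chart_dom c" if "x \<in> topspace X" "u x \<noteq> 0" for x using cu that by (simp add: J_def)
  next
    fix x assume "x \<in> topspace X"
    then obtain i where "i \<in> I" "x \<in> B i" using I(3) by blast
    then show "\<exists>(c, u)\<in>I. 0 < u x" by (auto simp: B_def)
  qed
qed

end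

section \<open>The Higson compactification of a leaf\<close>

locale regular_leaf = regular_foliation X \<A> \<U>
  for X :: "'a topology" and \<A> \<U> :: "('a, 'n::finite, 'z) chart set" +
  fixes L :: "'a set"
  assumes leaf: "L \<in> leaves X \<A>"
begin

abbreviation "T \<equiv> leaf_space X \<A> L"
abbreviation "d \<equiv> plaque_dist X \<A> \<U>"

sublocale dist_space T d
  by unfold_locales (simp add: plaque_dist_def)

lemma topspace_T: "topspace T = L"
  using leaf_subset[OF leaf] by (simp add: leaf_space_def topspace_leaf_topology Int_absorb1)

lemma compactin_T: "compactin T K \<longleftrightarrow> compactin (leaf_topology X \<A>) K \<and> K \<subseteq> L"
  by (simp add: leaf_space_def compactin_subtopology)

lemma dist_le_iff: "x \<in> L \<Longrightarrow> y \<in> L \<Longrightarrow> d x y \<le> k \<longleftrightarrow> (x, y) \<in> E ^^ k"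
  by (rule plaque_dist_le_iff[OF leaf])

lemma dist_sym:
  assumes "x \<in> L" "y \<in> L"
  shows "d x y = d y x"
  using assms dist_le_iff[of x y "d y x"] dist_le_iff[of y x "d x y"] dist_le_iff[of x y "d x y"]
    dist_le_iff[of y x "d y x"] relpow_adj_sym by (meson le_antisym order_refl)

lemma dist_triangle:
  assumes "x \<in> L" "y \<in> L" "z \<in> L"
  shows "d x z \<le> d x y + d y z"
  using assms dist_le_iff[of x y "d x y"] dist_le_iff[of y z "d y z"] dist_le_iff[of x z] relpow_trans[of x y "d x y" E z "d y z"]
  by simp

lemma ball_compact:
  assumes "x \<in> L"
  obtains K where "compactin T K" "\<And>y. y \<in> L \<Longrightarrow> d x y \<le> k \<Longrightarrow> y \<in> K"
proof -
  obtain K where K: "compactin (leaf_topology X \<A>) K" "K \<subseteq> L" "(E ^^ k) `` {x} \<subseteq> K"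
    by (rule ball_compact_hull[OF leaf assms])
  show thesis
  proof (rule that)
    show "compactin T K" using K by (simp add: compactin_T)
    show "y \<in> K" if "y \<in> L" "d x y \<le> k" for y
      using that dist_le_iff[OF assms, of y k] K(3) by blast
  qed
qed

subsection \<open>Recurrence of the leaves of a minimal foliation\<close>

text \<open>Density is used for the leaf through every point of \<open>X\<close>, because it is
  \<open>X\<close> whose compactness yields a uniform radius; the radius is then restricted to
  \<open>L\<close>.\<close>

lemma minimal_imp_net:
  assumes "minimal_foliation X \<A>" and W: "openin X W" "W \<noteq> {}"
  obtains R where "\<And>x. x \<in> L \<Longrightarrow> \<exists>y\<in>L \<inter> W. d x y \<le> R"
proof -
  define B where "B k = (E ^^ k) `` W" for k
  have "openin X (B k)" for k unfolding B_def by (rule openin_relpow_adj_Image[OF W(1)])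
  moreover have "topspace X \<subseteq> \<Union>(range B)"
  proof
    fix p assume "p \<in> topspace X"
    then have "p \<in> \<Union>(leaves X \<A>)"
      by (simp add: leaves_def Union_connected_components_of topspace_leaf_topology)
    then obtain M where M: "M \<in> leaves X \<A>" "p \<in> M" by blast
    then have "X closure_of M = topspace X" using assms(1) by (simp add: minimal_foliation_def)
    moreover have "W \<inter> topspace X \<noteq> {}" using W openin_subset by blast
    ultimately have "W \<inter> M \<noteq> {}" using openin_Int_closure_of_eq_empty[OF W(1), of M] by simp
    then obtain y where y: "y \<in> W" "y \<in> M" by blast
    obtain k where "(y, p) \<in> E ^^ k" by (rule leaf_chain_connected[OF M(1) y(2) M(2)])
    then show "p \<in> \<Union>(range B)" using y(1) unfolding B_def by blast
  qed
  moreover have "compactin X (topspace X)" using compact by (simp add: compact_space_def)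
  ultimately obtain \<F> where "finite \<F>" "\<F> \<subseteq> range B" "topspace X \<subseteq> \<Union>\<F>"
    using compactinD[of X "topspace X" "range B"] by blast
  then obtain N where N: "finite N" "topspace X \<subseteq> \<Union>(B ` N)" by (metis finite_subset_image)
  show thesis
  proof (rule that)
    fix x assume x: "x \<in> L"
    then have "x \<in> topspace X" using leaf_subset[OF leaf] by blast
    then obtain n where n: "n \<in> N" "x \<in> B n" using N(2) by blast
    then obtain y where y: "y \<in> W" "(y, x) \<in> E ^^ n" by (auto simp: B_def)
    have "y \<in> topspace X" using y(1) openin_subset[OF W(1)] by blast
    then have "(y, x) \<in> E ^^ Max N" using relpow_adj_mono[OF y(2)] n N(1) by simp
    then have xy: "(x, y) \<in> E ^^ Max N" by (rule relpow_adj_sym)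
    then have "y \<in> L" by (rule relpow_adj_leaf[OF leaf x])
    then show "\<exists>y\<in>L \<inter> W. d x y \<le> Max N" using xy y(1) dist_le_iff[OF x] by blast
  qed
qed

text \<open>A basic open set for pointwise convergence constrains finitely many coordinates, so an
  evaluation outside it deviates from \<open>e\<close> at one of them.\<close>

lemma higson_neighbourhood:
  assumes W: "openin (higson_compactification T d) W" "e \<in> W"
  obtains \<F> \<epsilon> where "finite \<F>" "\<F> \<subseteq> higson_algebra T d" "0 < \<epsilon>"
    "\<And>x. x \<in> L \<Longrightarrow> higson_embedding T d x \<notin> W \<Longrightarrow> \<exists>f\<in>\<F>. \<epsilon> \<le> cmod (f x - e f)"
proof -
  let ?A = "higson_algebra T d"
  obtain G where G: "openin (product_topology (\<lambda>_. euclidean) ?A) G" "W = G \<inter> higson_characters T d"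
    using W(1) by (auto simp: higson_compactification_def openin_subtopology)
  have "e \<in> G" using W(2) G(2) by blast
  then obtain U where U: "finite {f \<in> ?A. U f \<noteq> UNIV}" "\<And>f. f \<in> ?A \<Longrightarrow> open (U f)"
     "e \<in> Pi\<^sub>E ?A U" "Pi\<^sub>E ?A U \<subseteq> G"
    using G(1) by (auto simp: openin_product_topology_alt)
  define \<F> where "\<F> = {f \<in> ?A. U f \<noteq> UNIV}"
  have "\<forall>f\<in>\<F>. \<exists>r>0. ball (e f) r \<subseteq> U f"
  proof
    fix f assume "f \<in> \<F>"
    then have "f \<in> ?A" by (simp add: \<F>_def)
    then have "e f \<in> U f" using U(3) by (rule PiE_mem[rotated])
    then show "\<exists>r>0. ball (e f) r \<subseteq> U f" using openE[OF U(2)[OF \<open>f \<in> ?A\<close>]] by metis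
  qed
  from bchoice[OF this] obtain r where r: "\<forall>f\<in>\<F>. 0 < r f \<and> ball (e f) (r f) \<subseteq> U f" ..
  \<comment> \<open>Inserting \<open>1\<close> keeps the minimum defined when no coordinate is
    constrained.\<close>
  define \<epsilon> where "\<epsilon> = Min (insert 1 (r ` \<F>))"
  have fin: "finite \<F>" using U(1) by (simp add: \<F>_def)
  show thesis
  proof (rule that[OF fin])
    show "\<F> \<subseteq> ?A" by (auto simp: \<F>_def)
    show "0 < \<epsilon>" using fin r by (auto simp: \<epsilon>_def)
    fix x assume x: "x \<in> L" "higson_embedding T d x \<notin> W"
    then have "higson_embedding T d x \<in> higson_characters T d"
      using higson_embedding_character topspace_T by blast
    with x(2) U(4) have "higson_embedding T d x \<notin> Pi\<^sub>E ?A U" using G(2) by blast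
    then obtain f where f: "f \<in> ?A" "f x \<notin> U f"
      by (auto simp: higson_embedding_def)
    then have "f \<in> \<F>" by (auto simp: \<F>_def)
    moreover from this have "r f \<le> cmod (f x - e f)"
      using r f(2) by (force simp: subset_iff dist_norm norm_minus_commute)
    moreover have "\<epsilon> \<le> r f" using \<open>f \<in> \<F>\<close> fin by (simp add: \<epsilon>_def)
    ultimately show "\<exists>f\<in>\<F>. \<epsilon> \<le> cmod (f x - e f)" by force
  qed
qed

lemma corona_point_not_separated_from_net:
  assumes e: "e \<in> higson_corona T d" and W: "openin (higson_compactification T d) W" "e \<in> W"
    and net: "\<And>x. x \<in> L \<Longrightarrow> \<exists>y\<in>S. d x y \<le> R" and "S \<subseteq> L"
  shows "\<exists>x\<in>S. higson_embedding T d x \<in> W"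
proof (rule ccontr)
  assume contra: "\<not> ?thesis"
  have echar: "e \<in> higson_characters T d" and enot: "e \<notin> higson_embedding T d ` topspace T"
    using e by (auto simp: higson_corona_def topspace_higson_compactification)
  obtain \<F> \<epsilon> where F: "finite \<F>" "\<F> \<subseteq> higson_algebra T d" and "0 < \<epsilon>"
    and far: "\<And>x. x \<in> L \<Longrightarrow> higson_embedding T d x \<notin> W \<Longrightarrow> \<exists>f\<in>\<F>. \<epsilon> \<le> cmod (f x - e f)"
    using higson_neighbourhood[OF W] by blast
  define g where "g x = (\<Sum>f\<in>\<F>. (cmod (f x - e f))\<^sup>2)" for x
  define G where "G = (\<lambda>x\<in>topspace T. complex_of_real (g x))"
  have G: "G \<in> higson_algebra T d" "e G = 0"
    using character_deviation_sum[OF echar F] unfolding G_def g_def by blast+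
  have gS: "\<epsilon>\<^sup>2 \<le> g y" if y: "y \<in> S" for y
  proof -
    have "higson_embedding T d y \<notin> W" "y \<in> L" using contra y \<open>S \<subseteq> L\<close> by auto
    then obtain f where f: "f \<in> \<F>" "\<epsilon> \<le> cmod (f y - e f)" using far by blast
    then have "\<epsilon>\<^sup>2 \<le> (cmod (f y - e f))\<^sup>2" using \<open>0 < \<epsilon>\<close> by (intro power_mono) auto
    also have "\<dots> \<le> g y" unfolding g_def using F(1) f(1) by (intro member_le_sum) auto
    finally show ?thesis .
  qed
  \<comment> \<open>Half of the lower bound \<open>\<epsilon>\<^sup>2\<close> on \<open>S\<close> is
    spent on the oscillation over distance \<open>R\<close>; the other half remains as a bound
    outside \<open>K\<close>.\<close>
  have pos: "0 < \<epsilon>\<^sup>2 / 2" using \<open>0 < \<epsilon>\<close> by simp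
  obtain K where K: "compactin T K"
    "\<And>x y. x \<in> topspace T - K \<Longrightarrow> y \<in> topspace T \<Longrightarrow> d x y \<le> R \<Longrightarrow> cmod (G x - G y) < \<epsilon>\<^sup>2 / 2"
    using higson_algebra_slow[OF G(1) pos] by blast
  have "\<epsilon>\<^sup>2 / 2 \<le> g x" if x: "x \<in> topspace T - K" for x
  proof -
    obtain y where y: "y \<in> S" "d x y \<le> R" using net x topspace_T by blast
    then have yT: "y \<in> topspace T" using \<open>S \<subseteq> L\<close> topspace_T by blast
    have "G x - G y = complex_of_real (g x - g y)" using x yT by (simp add: G_def)
    then have "\<bar>g x - g y\<bar> < \<epsilon>\<^sup>2 / 2" using K(2)[OF x yT y(2)] by (simp only: norm_of_real real_norm_def)
    then show ?thesis using gS[OF y(1)] by linarith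
  qed
  moreover have "0 \<le> g x" for x unfolding g_def by (simp add: sum_nonneg)
  ultimately have "e \<in> higson_embedding T d ` topspace T"
    using G pos K(1) unfolding G_def by (intro character_evaluation[OF echar])
  then show False using enot by blast
qed

lemma minimal_imp_recurrent:
  assumes "minimal_foliation X \<A>"
  shows "higson_recurrent X \<A> \<U> L"
  unfolding higson_recurrent_def
proof
  fix e assume e: "e \<in> higson_corona T d"
  let ?C = "higson_compactification T d"
  let ?N = "\<lambda>V. {x \<in> L. higson_embedding T d x \<in> V}"
  let ?V = "\<lambda>V. V \<subseteq> topspace ?C \<and> (\<exists>W. openin ?C W \<and> e \<in> W \<and> W \<subseteq> V)"
  have dense: "X closure_of ?N V = topspace X" if V: "?V V" for V
  proof -
    obtain W where W: "openin ?C W" "e \<in> W" "W \<subseteq> V" using V by blast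
    have "\<exists>x\<in>L \<inter> G. higson_embedding T d x \<in> V" if G: "openin X G" "G \<noteq> {}" for G
    proof -
      obtain R where "\<And>x. x \<in> L \<Longrightarrow> \<exists>y\<in>L \<inter> G. d x y \<le> R"
        using minimal_imp_net[OF assms G] by blast
      then show ?thesis using corona_point_not_separated_from_net[OF e W(1,2), of "L \<inter> G" R] W(3) by blast
    qed
    then have "topspace X \<subseteq> X closure_of ?N V" unfolding in_closure_of subset_iff by blast
    then show ?thesis using closure_of_subset_topspace by (rule equalityI[rotated])
  qed
  \<comment> \<open>The intersection must be over a nonempty family; otherwise it would be the whole
    type.\<close>
  have "?V (topspace ?C)" using e by (auto simp: higson_corona_def)
  then have "\<Inter> {X closure_of ?N V | V. ?V V} = topspace X" using dense by blast
  then show "higson_limit_set X \<A> \<U> L e = topspace X" by (simp add: higson_limit_set_def Let_def)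
qed

subsection \<open>Smoothing along the plaques\<close>

text \<open>Quantifying over all bounds replaces infima and suprema over unit balls. The one
  property yields boundedness, exact values where \<open>v\<close> is constant nearby, and closeness
  to \<open>v\<close> where it oscillates little.\<close>

definition smoothing :: "('a \<Rightarrow> real) \<Rightarrow> ('a \<Rightarrow> real) \<Rightarrow> bool" where
  "smoothing v F \<longleftrightarrow> (\<forall>x\<in>L. \<forall>a b. (\<forall>y\<in>L. d x y \<le> 1 \<longrightarrow> a \<le> v y \<and> v y \<le> b) \<longrightarrow> a \<le> F x \<and> F x \<le> b)"

lemma smoothingD:
  assumes "smoothing v F" "x \<in> L" "\<And>y. y \<in> L \<Longrightarrow> d x y \<le> 1 \<Longrightarrow> a \<le> v y \<and> v y \<le> b"
  shows "a \<le> F x \<and> F x \<le> b"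
  using assms unfolding smoothing_def by blast

text \<open>The smoothed function averages, with continuous weights, the values at representatives of the
  plaques through a point; hence it lies between any bounds valid on the unit ball.\<close>

lemma plaque_smoothing:
  fixes v :: "'a \<Rightarrow> real"
  assumes bound: "\<And>x. x \<in> L \<Longrightarrow> \<bar>v x\<bar> \<le> B"
  obtains F where "continuous_map T euclideanreal F" "smoothing v F"
proof -
  obtain I :: "(('a, 'n, 'z) chart \<times> ('a \<Rightarrow> real)) set" where I: "finite I"
    and cont: "\<And>c u. (c, u) \<in> I \<Longrightarrow> c \<in> \<U> \<and> continuous_map X euclideanreal u"
    and nonneg: "\<And>c u x. (c, u) \<in> I \<Longrightarrow> x \<in> topspace X \<Longrightarrow> 0 \<le> u x"
    and supp: "\<And>c u x. (c, u) \<in> I \<Longrightarrow> x \<in> topspace X \<Longrightarrow> u x \<noteq> 0 \<Longrightarrow> x \<in> chart_dom c"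
    and cover: "\<And>x. x \<in> topspace X \<Longrightarrow> \<exists>(c, u)\<in>I. 0 < u x"
    by (rule chart_cutoffs) (rule that)
  have LX: "x \<in> topspace X" if "x \<in> L" for x using that leaf_subset[OF leaf] by blast
  \<comment> \<open>The representative depends only on the plaque, so on \<open>chart_dom c\<close>
    the function \<open>w c\<close> is locally constant for the leaf topology, even where
    \<open>v\<close> is discontinuous.\<close>
  define w where "w c x = v (SOME q. q \<in> plaque_at c x)" for c :: "('a, 'n, 'z) chart" and x
  define S where "S x = (\<Sum>(c, u)\<in>I. u x)" for x
  define N where "N x = (\<Sum>(c, u)\<in>I. u x * w c x)" for x
  have rep: "(SOME q. q \<in> plaque_at c x) \<in> L \<and> d x (SOME q. q \<in> plaque_at c x) \<le> 1"
    if "c \<in> \<U>" "x \<in> L" "x \<in> chart_dom c" for c x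
  proof -
    have "(SOME q. q \<in> plaque_at c x) \<in> plaque_at c x"
      using plaque_at_self[OF that(3)] by (rule someI)
    then have adj: "(x, SOME q. q \<in> plaque_at c x) \<in> E"
      using that(1,3) by (auto simp: plaque_adj_def)
    then have "(SOME q. q \<in> plaque_at c x) \<in> L" by (rule adj_leaf[OF leaf that(2)])
    then show ?thesis using adj dist_le_iff[OF that(2), of _ 1] by simp
  qed
  have Spos: "0 < S x" if x: "x \<in> L" for x
  proof -
    obtain c u where "(c, u) \<in> I" "0 < u x" using cover[OF LX[OF x]] by blast
    then show ?thesis unfolding S_def
      using I nonneg LX[OF x] by (intro sum_pos2[of I "(c, u)"]) auto
  qed
  have ucont: "continuous_map T euclideanreal u" if "(c, u) \<in> I" for c u
    unfolding leaf_space_def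
    using cont[OF that] continuous_map_leaf_topology by (intro continuous_map_from_subtopology) blast
  have "continuous_map T euclideanreal (\<lambda>x. u x * w c x)" if cu: "(c, u) \<in> I" for c u
    unfolding continuous_map_atin limitin_canonical_iff
  proof
    fix x assume "x \<in> topspace T"
    then have x: "x \<in> L" by (simp add: topspace_T)
    have ulim: "(u \<longlongrightarrow> u x) (atin T x)"
      using ucont[OF cu] \<open>x \<in> topspace T\<close> by (simp add: continuous_map_atin)
    show "((\<lambda>x. u x * w c x) \<longlongrightarrow> u x * w c x) (atin T x)"
    proof (cases "x \<in> chart_dom c")
      case True
      have "openin T (plaque_at c x \<inter> L)"
        unfolding leaf_space_def openin_subtopology
        using openin_leaf_plaque[OF regular_foliated_chart True] cont[OF cu] by blast
      moreover have "x \<in> plaque_at c x \<inter> L" using plaque_at_self[OF True] x by blast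
      moreover have "w c x = w c y" if "y \<in> plaque_at c x \<inter> L" for y
        using plaque_at_eq[of y c x] that by (simp add: w_def)
      ultimately have "\<forall>\<^sub>F y in atin T x. w c x = w c y"
        unfolding eventually_atin by blast
      then have "(w c \<longlongrightarrow> w c x) (atin T x)"
        by (rule Lim_transform_eventually[OF tendsto_const])
      with ulim show ?thesis by (rule tendsto_mult)
    next
      case False
      \<comment> \<open>Outside the domain nothing is known about continuity of \<open>w c\<close>.
        The product still tends to zero: \<open>u\<close> does, and \<open>w c\<close> is bounded by
        \<open>B\<close> wherever \<open>u\<close> is nonzero.\<close>
      then have u0: "u x = 0" using supp[OF cu LX[OF x]] by blast
      have "norm (u y * w c y) \<le> u y * B" if y: "y \<in> L" for y
      proof (cases "u y = 0")
        case False
        then have "y \<in> chart_dom c" using supp[OF cu LX[OF y]] by blast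
        then have "\<bar>w c y\<bar> \<le> B" using rep[of c y] cont[OF cu] y by (simp add: w_def bound)
        then show ?thesis using nonneg[OF cu LX[OF y]] by (simp add: abs_mult mult_left_mono)
      qed simp
      moreover have "openin T L" using openin_topspace[of T] by (simp only: topspace_T)
      ultimately have "\<forall>\<^sub>F y in atin T x. norm (u y * w c y) \<le> u y * B"
        unfolding eventually_atin using x by blast
      moreover have "((\<lambda>y. u y * B) \<longlongrightarrow> 0) (atin T x)"
        using tendsto_mult_right[OF ulim, of B] u0 by simp
      ultimately show ?thesis using u0 by (simp add: Lim_null_comparison)
    qed
  qed
  then have "continuous_map T euclideanreal N" "continuous_map T euclideanreal S"
    unfolding N_def S_def using I ucont by (auto intro!: continuous_map_sum)
  then have NS: "continuous_map T euclideanreal (\<lambda>x. N x / S x)"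
    using Spos topspace_T by (intro continuous_map_real_divide) force+
  have "a \<le> N x / S x \<and> N x / S x \<le> b"
    if x: "x \<in> L" and ab: "\<And>y. y \<in> L \<Longrightarrow> d x y \<le> 1 \<Longrightarrow> a \<le> v y \<and> v y \<le> b" for x a b
  proof -
    have "u x * a \<le> u x * w c x \<and> u x * w c x \<le> u x * b" if cu: "(c, u) \<in> I" for c u
    proof (cases "u x = 0")
      case False
      then have "x \<in> chart_dom c" using supp[OF cu LX[OF x]] by blast
      then have "a \<le> w c x \<and> w c x \<le> b" using rep[of c x] cont[OF cu] x by (simp add: w_def ab)
      then show ?thesis using nonneg[OF cu LX[OF x]] by (simp add: mult_left_mono)
    qed simp
    then have "(\<Sum>(c, u)\<in>I. u x * a) \<le> N x \<and> N x \<le> (\<Sum>(c, u)\<in>I. u x * b)"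
      unfolding N_def by (auto intro!: sum_mono)
    then have "S x * a \<le> N x \<and> N x \<le> S x * b"
      unfolding S_def by (simp add: sum_distrib_right case_prod_unfold)
    then show ?thesis using Spos[OF x] by (simp add: pos_le_divide_eq pos_divide_le_eq mult.commute)
  qed
  then have "smoothing v (\<lambda>x. N x / S x)" unfolding smoothing_def by (intro ballI allI impI) blast
  with NS show thesis by (rule that)
qed

text \<open>The hypothesis on \<open>v\<close> is slow oscillation without continuity, with balls
  around \<open>p\<close> in the role of compact sets, as balls lie in compact sets. Smoothing sees
  one unit further, whence the radius \<open>R + 1\<close>; \<open>F x\<close> and
  \<open>F y\<close> are both compared with \<open>v x\<close>, at a cost of
  \<open>\<epsilon> / 3\<close> each.\<close>

lemma smoothing_higson:
  fixes v :: "'a \<Rightarrow> real"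
  assumes bound: "\<And>x. x \<in> L \<Longrightarrow> \<bar>v x\<bar> \<le> B" and p: "p \<in> L"
    and slow: "\<And>R \<epsilon>. 0 < \<epsilon> \<Longrightarrow> \<exists>m. \<forall>x\<in>L. \<forall>y\<in>L. m < d p x \<longrightarrow> d x y \<le> R \<longrightarrow> \<bar>v x - v y\<bar> < \<epsilon>"
  obtains F where "(\<lambda>x\<in>topspace T. complex_of_real (F x)) \<in> higson_algebra T d" "smoothing v F"
proof -
  obtain F where F: "continuous_map T euclideanreal F"
    and sm: "smoothing v F"
    by (rule plaque_smoothing[OF bound])
  note Fab = smoothingD[OF sm]
  have "(\<lambda>x\<in>topspace T. complex_of_real (F x)) \<in> higson_algebra T d"
  proof (rule higson_algebraI[where B = B])
    show "continuous_map T euclidean (\<lambda>x. complex_of_real (F x))"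
      using F by (fastforce simp: continuous_map_atin tendsto_of_real)
  next
    fix x assume "x \<in> topspace T"
    then have "- B \<le> F x \<and> F x \<le> B"
      using bound by (intro Fab) (auto simp: topspace_T abs_le_iff minus_le_iff)
    then show "cmod (complex_of_real (F x)) \<le> B" by (simp add: abs_le_iff minus_le_iff)
  next
    fix R :: nat and \<epsilon> :: real
    assume "0 < \<epsilon>"
    then obtain m where m: "\<And>x y. x \<in> L \<Longrightarrow> y \<in> L \<Longrightarrow> m < d p x \<Longrightarrow> d x y \<le> R + 1 \<Longrightarrow> \<bar>v x - v y\<bar> < \<epsilon> / 3"
      using slow[of "\<epsilon> / 3" "R + 1"] by auto
    obtain K where K: "compactin T K" "\<And>y. y \<in> L \<Longrightarrow> d p y \<le> m \<Longrightarrow> y \<in> K"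
      using ball_compact[OF p] by blast
    have near: "\<bar>F y - v x\<bar> \<le> \<epsilon> / 3" if "x \<in> L" "y \<in> L" "m < d p x" "d x y \<le> R" for x y
    proof -
      have "v x - \<epsilon> / 3 \<le> v z \<and> v z \<le> v x + \<epsilon> / 3" if z: "z \<in> L" "d y z \<le> 1" for z
      proof -
        have "d x z \<le> R + 1" using dist_triangle[OF \<open>x \<in> L\<close> \<open>y \<in> L\<close> z(1)] z(2) \<open>d x y \<le> R\<close> by linarith
        then have "\<bar>v x - v z\<bar> < \<epsilon> / 3" using m[OF \<open>x \<in> L\<close> z(1) \<open>m < d p x\<close>] by blast
        then show ?thesis by linarith
      qed
      then have "v x - \<epsilon> / 3 \<le> F y \<and> F y \<le> v x + \<epsilon> / 3" using Fab[OF \<open>y \<in> L\<close>] by blast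
      then show ?thesis by linarith
    qed
    have "cmod (complex_of_real (F x) - complex_of_real (F y)) < \<epsilon>"
      if "x \<in> topspace T - K" "y \<in> topspace T" "d x y \<le> R" for x y
    proof -
      have x: "x \<in> L" "y \<in> L" using that by (auto simp: topspace_T)
      have "m < d p x" using that(1) K(2)[OF x(1)] by (meson DiffD2 not_le)
      note x = x this
      have "\<bar>F x - v x\<bar> \<le> \<epsilon> / 3" using near[OF x(1,1,3)] dist_refl by simp
      moreover have "\<bar>F y - v x\<bar> \<le> \<epsilon> / 3" using near[OF x] that(3) by blast
      ultimately have "\<bar>F x - F y\<bar> < \<epsilon>" using \<open>0 < \<epsilon>\<close> by linarith
      then show ?thesis by (simp flip: of_real_diff)
    qed
    with K(1) show "\<exists>K. compactin T K \<and> (\<forall>x\<in>topspace T - K. \<forall>y\<in>topspace T. d x y \<le> R \<longrightarrow>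
        cmod (complex_of_real (F x) - complex_of_real (F y)) < \<epsilon>)" by blast
  qed
  then show thesis using sm by (rule that)
qed

subsection \<open>Minimality from recurrence\<close>

lemma escaping_balls:
  assumes noncompact: "\<not> compact_space T" and "\<not> minimal_foliation X \<A>" and p: "p \<in> L"
  obtains W where "openin X W" "W \<noteq> {}"
    "\<And>k. \<exists>x\<in>L. k < d p x \<and> (\<forall>y\<in>L. d x y \<le> k \<longrightarrow> y \<notin> W)"
proof (cases "X closure_of L = topspace X")
  case False
  show thesis
  proof (rule that)
    show "openin X (topspace X - X closure_of L)" by (simp add: openin_diff)
    show "topspace X - X closure_of L \<noteq> {}" using False closure_of_subset_topspace[of X L] by blast
    fix k
    obtain K where K: "compactin T K" "\<And>y. y \<in> L \<Longrightarrow> d p y \<le> k \<Longrightarrow> y \<in> K"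
      using ball_compact[OF p] by blast
    \<comment> \<open>A bounded leaf would lie in a single compact hull. Being far from
      \<open>p\<close> is all that is required here, since no point of \<open>L\<close> is in the
      chosen open set.\<close>
    have "\<exists>x\<in>L. k < d p x"
    proof (rule ccontr)
      assume "\<not> ?thesis"
      then have "L \<subseteq> K" using K(2) by (force simp: not_less)
      then have "compactin T (topspace T)" using K(1) compactin_T topspace_T by (metis subset_antisym)
      then show False using noncompact by (simp add: compact_space_def)
    qed
    moreover have "L \<subseteq> X closure_of L" by (rule closure_of_subset[OF leaf_subset[OF leaf]])
    ultimately show "\<exists>x\<in>L. k < d p x \<and> (\<forall>y\<in>L. d x y \<le> k \<longrightarrow> y \<notin> topspace X - X closure_of L)"
      by blast
  qed
next
  case True
  have meets: "L \<inter> G \<noteq> {}" if "openin X G" "G \<noteq> {}" for G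
    using that openin_subset[OF that(1)] True openin_Int_closure_of_eq_empty[OF that(1), of L]
    by (metis Int_commute Int_absorb2)
  obtain M where M: "M \<in> leaves X \<A>" "X closure_of M \<noteq> topspace X"
    using assms(2) by (auto simp: minimal_foliation_def)
  have Msub: "M \<subseteq> X closure_of M" by (rule closure_of_subset[OF leaf_subset[OF M(1)]])
  obtain q where q: "q \<in> topspace X" "q \<notin> X closure_of M"
    using M(2) closure_of_subset_topspace[of X M] by blast
  \<comment> \<open>A closed set \<open>C\<close> is placed between \<open>W\<close> and the
    complement of the closure of \<open>M\<close>, because the image under closed chains is known to
    be closed only for closed sets.\<close>
  have "normal_space X" "Hausdorff_space X"
    using compact Hausdorff by (auto simp: compact_Hausdorff_or_regular_imp_normal_space)
  then have "neighbourhood_base_of (closedin X) X"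
    by (simp add: neighbourhood_base_of_closedin normal_t1_imp_regular_space Hausdorff_imp_t1_space)
  moreover have "openin X (topspace X - X closure_of M)" "q \<in> topspace X - X closure_of M"
    using q by (auto simp: openin_diff)
  ultimately obtain W C where W: "openin X W" "closedin X C" "q \<in> W" "W \<subseteq> C" "C \<subseteq> topspace X - X closure_of M"
    unfolding neighbourhood_base_of by meson
  obtain p' where p': "p' \<in> L" "p' \<in> W" using meets[OF W(1)] W(3) by blast
  show thesis
  proof (rule that[OF W(1)])
    show "W \<noteq> {}" using W(3) by blast
    fix k
    \<comment> \<open>The point \<open>p'\<close> of \<open>L \<inter> W\<close> converts distance
      from \<open>W\<close> into distance from \<open>p\<close>: being more than \<open>m\<close>
      away from \<open>p'\<close> leaves more than \<open>k\<close> from \<open>p\<close>.\<close>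
    define m where "m = k + d p p'"
    define D where "D = (closed_adj ^^ m) `` C"
    \<comment> \<open>Closed chains do not leave a leaf, and \<open>M\<close> misses
      \<open>C\<close>. The complement of \<open>D\<close> is thus open and nonempty, so the dense
      leaf \<open>L\<close> meets it.\<close>
    have "M \<inter> D = {}"
    proof (rule ccontr)
      assume "M \<inter> D \<noteq> {}"
      then obtain y z where y: "y \<in> M" "z \<in> C" "(z, y) \<in> closed_adj ^^ m" by (auto simp: D_def)
      have sym: "(b, a) \<in> closed_adj" if "(a, b) \<in> closed_adj" for a b
        using that by (fastforce simp: closed_adj_def)
      have "(y, z) \<in> closed_adj ^^ m" using sym y(3) by (rule relpow_sym)
      then have "z \<in> M" by (rule relpow_closed_adj_leaf[OF M(1) y(1)])
      then show False using y(2) W(5) Msub by blast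
    qed
    moreover have "closedin X D" unfolding D_def by (rule closedin_relpow_closed_adj_Image[OF W(2)])
    ultimately have "openin X (topspace X - D)" "topspace X - D \<noteq> {}"
      using leaf_subset[OF M(1)] leaf_nonempty[OF M(1)] by (auto simp: openin_diff)
    then obtain x where x: "x \<in> L" "x \<notin> D" using meets by blast
    have far: "y \<notin> W" if y: "y \<in> L" "d x y \<le> m" for y
    proof
      assume "y \<in> W"
      have "(x, y) \<in> E ^^ m" using y dist_le_iff[OF x(1)] by blast
      then have "(y, x) \<in> E ^^ m" by (rule relpow_adj_sym)
      then have "(y, x) \<in> closed_adj ^^ m"
        using relpowp_mono[to_set, of E closed_adj] plaque_adj_closed_adj by blast
      then show False using x(2) \<open>y \<in> W\<close> W(4) by (auto simp: D_def)
    qed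
    have "m < d x p'" using far[OF p'(1)] p'(2) by (simp add: not_le[symmetric]) blast
    then have "k < d p x"
      using dist_triangle[OF x(1) p p'(1)] dist_sym[OF x(1) p] by (simp add: m_def)
    moreover have "y \<notin> W" if "y \<in> L" "d x y \<le> k" for y
      using far[OF that(1)] that(2) by (simp add: m_def)
    ultimately show "\<exists>x\<in>L. k < d p x \<and> (\<forall>y\<in>L. d x y \<le> k \<longrightarrow> y \<notin> W)" using x(1) by blast
  qed
qed

text \<open>The tents over the balls of radius \<open>k + 1\<close> centred at the escaping points \<open>x k\<close> have slopes
  tending to zero, so their supremum is slowly oscillating.\<close>

lemma tents:
  fixes x :: "nat \<Rightarrow> 'a"
  assumes p: "p \<in> L" and x: "\<And>k. x k \<in> L"
  obtains v :: "'a \<Rightarrow> real" where "\<And>z. 0 \<le> v z" "\<And>z. v z \<le> 1"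
    "\<And>k z. 1 - real (d z (x k)) / (real k + 1) \<le> v z"
    "\<And>z. \<forall>k. k + 1 \<le> d z (x k) \<Longrightarrow> v z = 0"
    "\<And>R \<epsilon>. 0 < \<epsilon> \<Longrightarrow> \<exists>m. \<forall>y\<in>L. \<forall>z\<in>L. m < d p y \<longrightarrow> d y z \<le> R \<longrightarrow> \<bar>v y - v z\<bar> < \<epsilon>"
proof -
  define t where "t k z = max 0 (1 - real (d z (x k)) / (real k + 1))" for k z
  define v where "v z = (SUP k. t k z)" for z
  have t: "0 \<le> t k z" "t k z \<le> 1" for k z by (auto simp: t_def)
  have bdd: "bdd_above (range (\<lambda>k. t k z))" for z using t(2) by (intro bdd_aboveI2[of _ _ 1])
  have tv: "t k z \<le> v z" for k z unfolding v_def by (rule cSUP_upper[OF _ bdd]) simp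
  have v_le: "v z \<le> c" if "\<And>k. t k z \<le> c" for z c unfolding v_def using that by (intro cSUP_least) auto
  show thesis
  proof (rule that[of v])
    show "0 \<le> v z" for z using t(1)[of 0 z] tv[of 0 z] by linarith
    show "v z \<le> 1" for z using t(2) by (rule v_le)
    show "1 - real (d z (x k)) / (real k + 1) \<le> v z" for k z using tv[of k z] by (simp add: t_def)
    show "v z = 0" if far: "\<forall>k. k + 1 \<le> d z (x k)" for z
    proof -
      have "t k z = 0" for k using spec[OF far, of k] by (simp add: t_def field_simps)
      then show ?thesis by (simp add: v_def)
    qed
    fix R :: nat and \<epsilon> :: real
    assume "0 < \<epsilon>"
    \<comment> \<open>Tents of index at least \<open>n\<close> change by at most
      \<open>\<epsilon> / 2\<close> over distance \<open>R\<close>.\<close>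
    then obtain n :: nat where n: "real R * 2 / \<epsilon> < real n" using reals_Archimedean2 by blast
    \<comment> \<open>The first \<open>n\<close> tents vanish beyond distance
      \<open>d p (x k) + k + 1\<close> from \<open>p\<close>. The sum bounds all these radii at
      once, and the extra \<open>R\<close> keeps \<open>z\<close> off these tents as well as
      \<open>y\<close>.\<close>
    define m where "m = (\<Sum>k<n. d p (x k) + k + 1) + R"
    have small: "\<bar>t k y - t k z\<bar> \<le> \<epsilon> / 2" if yz: "y \<in> L" "z \<in> L" "m < d p y" "d y z \<le> R" for k y z
    proof (cases "k < n")
      case True
      have "d p (x k) + k + 1 \<le> (\<Sum>k<n. d p (x k) + k + 1)"
        using True by (intro member_le_sum) auto
      then have "d p (x k) + k + 1 + R < d p y" using yz(3) by (simp add: m_def)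
      moreover have "d p y \<le> d p (x k) + d y (x k)"
        using dist_triangle[OF p x yz(1), of k] dist_sym[OF yz(1) x, of k] by simp
      moreover have "d y (x k) \<le> d y z + d z (x k)" using dist_triangle[OF yz(1,2) x] .
      ultimately have "k + 1 \<le> d y (x k)" "k + 1 \<le> d z (x k)" using yz(4) by linarith+
      then have "t k y = 0" "t k z = 0" by (auto simp: t_def field_simps)
      then show ?thesis using \<open>0 < \<epsilon>\<close> by simp
    next
      case False
      have "d y (x k) \<le> R + d z (x k)" "d z (x k) \<le> R + d y (x k)"
        using dist_triangle[OF yz(1,2) x, of k] dist_triangle[OF yz(2,1) x, of k]
          dist_sym[OF yz(1,2)] yz(4) by linarith+
      then have "\<bar>real (d y (x k)) - real (d z (x k))\<bar> \<le> real R" by linarith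
      then have "\<bar>real (d y (x k)) - real (d z (x k))\<bar> / (real k + 1) \<le> real R / (real k + 1)"
        by (rule divide_right_mono) simp
      moreover have "\<bar>t k y - t k z\<bar> \<le> \<bar>real (d y (x k)) / (real k + 1) - real (d z (x k)) / (real k + 1)\<bar>"
        unfolding t_def by linarith
      moreover have "\<dots> = \<bar>real (d y (x k)) - real (d z (x k))\<bar> / (real k + 1)"
        by (simp flip: diff_divide_distrib)
      moreover have "real R / (real k + 1) \<le> \<epsilon> / 2"
      proof -
        have "real R * 2 / \<epsilon> \<le> real k + 1" using n False by linarith
        then show ?thesis using \<open>0 < \<epsilon>\<close> by (simp add: field_simps)
      qed
      ultimately show ?thesis by linarith
    qed
    have "\<bar>v y - v z\<bar> < \<epsilon>" if yz: "y \<in> L" "z \<in> L" "m < d p y" "d y z \<le> R" for y z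
    proof -
      have "v y \<le> v z + \<epsilon> / 2"
      proof (rule v_le)
        show "t k y \<le> v z + \<epsilon> / 2" for k using small[OF yz, of k] tv[of k z] by linarith
      qed
      moreover have "v z \<le> v y + \<epsilon> / 2"
      proof (rule v_le)
        show "t k z \<le> v y + \<epsilon> / 2" for k using small[OF yz, of k] tv[of k y] by linarith
      qed
      ultimately show ?thesis using \<open>0 < \<epsilon>\<close> by linarith
    qed
    then show "\<exists>m. \<forall>y\<in>L. \<forall>z\<in>L. m < d p y \<longrightarrow> d y z \<le> R \<longrightarrow> \<bar>v y - v z\<bar> < \<epsilon>" by blast
  qed
qed

text \<open>Evaluations are distinguished from limits along escaping sequences by smoothed bumps.\<close>

lemma limit_character_in_corona:
  assumes x: "\<And>k. x k \<in> L" and p: "p \<in> L" and esc: "\<And>k. k < d p (x k)"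
    and e: "e \<in> higson_characters T d"
    and lim: "\<And>f l. f \<in> higson_algebra T d \<Longrightarrow> (\<lambda>k. f (x k)) \<longlonglongrightarrow> l \<Longrightarrow> e f = l"
  shows "e \<in> higson_corona T d"
proof -
  have "e \<noteq> higson_embedding T d q" if q: "q \<in> L" for q
  proof
    assume eq: "e = higson_embedding T d q"
    \<comment> \<open>Radius one is chosen because smoothing at \<open>q\<close> looks at the unit
      ball, on which the bump is constant; hence \<open>F q\<close> is exactly
      \<open>1\<close>.\<close>
    define v :: "'a \<Rightarrow> real" where "v y = (if d q y \<le> 1 then 1 else 0)" for y
    have slow: "\<exists>m. \<forall>y\<in>L. \<forall>z\<in>L. m < d p y \<longrightarrow> d y z \<le> R \<longrightarrow> \<bar>v y - v z\<bar> < \<epsilon>"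
      if "0 < \<epsilon>" for R :: nat and \<epsilon> :: real
    proof (intro exI ballI impI)
      fix y z assume yz: "y \<in> L" "z \<in> L" "d p q + R + 1 < d p y" "d y z \<le> R"
      have "d p y \<le> d p q + d q y" using dist_triangle[OF p q yz(1)] .
      moreover have "d q y \<le> d q z + d y z"
        using dist_triangle[OF q yz(2,1)] dist_sym[OF yz(1,2)] by simp
      ultimately have "1 < d q y" "1 < d q z" using yz(3,4) by linarith+
      then show "\<bar>v y - v z\<bar> < \<epsilon>" using \<open>0 < \<epsilon>\<close> by (simp add: v_def)
    qed
    obtain F where F: "(\<lambda>x\<in>topspace T. complex_of_real (F x)) \<in> higson_algebra T d"
      and sm: "smoothing v F"
      by (rule smoothing_higson[of v 1, OF _ p slow]) (auto simp: v_def)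
    note Fab = smoothingD[OF sm]
    have "1 \<le> F q \<and> F q \<le> 1" by (rule Fab[OF q]) (simp add: v_def)
    then have 1: "F q = 1" by simp
    \<comment> \<open>Of the two extra units, one is for the bump and one for the smoothing.\<close>
    have 0: "F (x k) = 0" if k: "d p q + 2 \<le> k" for k
    proof -
      have "0 \<le> F (x k) \<and> F (x k) \<le> 0"
      proof (rule Fab[OF x])
        fix y assume y: "y \<in> L" "d (x k) y \<le> 1"
        have "d p (x k) \<le> d p q + d q (x k)" using dist_triangle[OF p q x] .
        moreover have "d q (x k) \<le> d q y + d (x k) y"
          using dist_triangle[OF q y(1) x, of k] dist_sym[OF y(1) x, of k] by simp
        ultimately have "1 < d q y" using y(2) k esc[of k] by linarith
        then show "0 \<le> v y \<and> v y \<le> 0" by (simp add: v_def)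
      qed
      then show ?thesis by simp
    qed
    have "(\<lambda>k. (\<lambda>x\<in>topspace T. complex_of_real (F x)) (x k)) \<longlonglongrightarrow> 0"
    proof (rule Lim_transform_eventually[OF tendsto_const])
      show "\<forall>\<^sub>F k in sequentially. 0 = (\<lambda>x\<in>topspace T. complex_of_real (F x)) (x k)"
        using eventually_ge_at_top[of "d p q + 2"] by eventually_elim (use x 0 in \<open>simp add: topspace_T\<close>)
    qed
    then have "e (\<lambda>x\<in>topspace T. complex_of_real (F x)) = 0" by (rule lim[OF F])
    moreover have "e (\<lambda>x\<in>topspace T. complex_of_real (F x)) = 1"
      unfolding eq higson_embedding_def restrict_apply'[OF F] using q by (simp add: topspace_T 1)
    ultimately show False by simp
  qed
  then show ?thesis
    using e by (auto simp: higson_corona_def topspace_higson_compactification topspace_T)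
qed

lemma recurrent_imp_minimal:
  assumes noncompact: "\<not> compact_space T" and rec: "higson_recurrent X \<A> \<U> L"
  shows "minimal_foliation X \<A>"
proof (rule ccontr)
  assume not_minimal: "\<not> minimal_foliation X \<A>"
  let ?C = "higson_compactification T d"
  obtain p where p: "p \<in> L" using leaf_nonempty[OF leaf] by blast
  obtain W where W: "openin X W" "W \<noteq> {}"
    and esc: "\<And>k. \<exists>x\<in>L. k < d p x \<and> (\<forall>y\<in>L. d x y \<le> k \<longrightarrow> y \<notin> W)"
    using escaping_balls[OF noncompact not_minimal p] by blast
  \<comment> \<open>With the shift, points of \<open>L \<inter> W\<close> are at distance at least
    \<open>k + 2\<close> from \<open>x k\<close>, so even their unit neighbours, which the smoothing
    sees, lie where the tent of radius \<open>k + 1\<close> vanishes.\<close>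
  have "\<forall>k. \<exists>x. x \<in> L \<and> k + 1 < d p x \<and> (\<forall>y\<in>L. d x y \<le> k + 1 \<longrightarrow> y \<notin> W)"
    using esc by blast
  from choice[OF this] obtain x where x: "\<And>k. x k \<in> L" "\<And>k. k + 1 < d p (x k)"
    "\<And>k y. y \<in> L \<Longrightarrow> d (x k) y \<le> k + 1 \<Longrightarrow> y \<notin> W" by blast
  obtain v :: "'a \<Rightarrow> real" where v: "\<And>z. 0 \<le> v z" "\<And>z. v z \<le> 1"
    "\<And>k z. 1 - real (d z (x k)) / (real k + 1) \<le> v z"
    "\<And>z. \<forall>k. k + 1 \<le> d z (x k) \<Longrightarrow> v z = 0"
    "\<And>R \<epsilon>. 0 < \<epsilon> \<Longrightarrow> \<exists>m. \<forall>y\<in>L. \<forall>z\<in>L. m < d p y \<longrightarrow> d y z \<le> R \<longrightarrow> \<bar>v y - v z\<bar> < \<epsilon>"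
    by (rule tents[of p x, OF p x(1)]) (rule that)
  have "\<bar>v z\<bar> \<le> 1" for z using v(1,2)[of z] by simp
  then obtain F where F: "(\<lambda>x\<in>topspace T. complex_of_real (F x)) \<in> higson_algebra T d"
    and sm: "smoothing v F"
    by (rule smoothing_higson[OF _ p v(5)])
  note Fab = smoothingD[OF sm]
  define f where "f = (\<lambda>x\<in>topspace T. complex_of_real (F x))"
  have f: "f \<in> higson_algebra T d" unfolding f_def by (rule F)
  have F_W: "F z = 0" if z: "z \<in> L" "z \<in> W" for z
  proof -
    have "0 \<le> F z \<and> F z \<le> 0"
    proof (rule Fab[OF z(1)])
      fix y assume y: "y \<in> L" "d z y \<le> 1"
      have "k + 1 \<le> d y (x k)" for k
      proof -
        have "k + 1 < d (x k) z" using x(3)[OF z(1), of k] z(2) by (meson not_le)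
        moreover have "d (x k) z \<le> d y (x k) + d z y"
          using dist_triangle[OF x(1) y(1) z(1), of k] dist_sym[OF y(1) x(1), of k] dist_sym[OF y(1) z(1)] by simp
        ultimately show ?thesis using y(2) by linarith
      qed
      then show "0 \<le> v y \<and> v y \<le> 0" using v(4)[of y] by simp
    qed
    then show ?thesis by simp
  qed
  \<comment> \<open>Smoothing lowers the peak by at most one step of the tent,
    \<open>1 / (k + 1)\<close>; growing radii make this loss vanish in the limit.\<close>
  have F_x: "1 - 1 / (real k + 1) \<le> F (x k) \<and> F (x k) \<le> 1" for k
  proof (rule Fab[OF x(1)])
    fix y assume y: "y \<in> L" "d (x k) y \<le> 1"
    then have "real (d y (x k)) / (real k + 1) \<le> 1 / (real k + 1)"
      using dist_sym[OF y(1) x(1), of k] by (intro divide_right_mono) auto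
    then show "1 - 1 / (real k + 1) \<le> v y \<and> v y \<le> 1" using v(2)[of y] v(3)[of y k] by linarith
  qed
  have "(\<lambda>k. F (x k)) \<longlonglongrightarrow> 1"
  proof (rule tendsto_sandwich)
    have "(\<lambda>k. 1 - inverse (real (Suc k))) \<longlonglongrightarrow> 1 - 0"
      by (intro tendsto_diff tendsto_const LIMSEQ_inverse_real_of_nat)
    then show "(\<lambda>k. 1 - 1 / (real k + 1)) \<longlonglongrightarrow> 1" by (simp add: inverse_eq_divide add.commute)
    show "(\<lambda>k. 1 :: real) \<longlonglongrightarrow> 1" by simp
  qed (use F_x in auto)
  then have f_lim: "(\<lambda>k. f (x k)) \<longlonglongrightarrow> 1"
    using tendsto_of_real[of "\<lambda>k. F (x k)" 1 sequentially, where 'a = complex] x(1)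
    by (simp add: f_def topspace_T)
  obtain e where e: "e \<in> higson_characters T d"
    and lim: "\<And>f l. f \<in> higson_algebra T d \<Longrightarrow> (\<lambda>k. f (x k)) \<longlonglongrightarrow> l \<Longrightarrow> e f = l"
    using character_limit[of x] x(1) topspace_T by blast
  have "k < d p (x k)" for k using x(2)[of k] by linarith
  then have "e \<in> higson_corona T d"
    by (rule limit_character_in_corona[of x, OF x(1) p _ e]) (rule lim)
  then have dense: "higson_limit_set X \<A> \<U> L e = topspace X"
    using rec by (simp add: higson_recurrent_def)
  \<comment> \<open>The open unit disc around \<open>1 = e f\<close> excludes \<open>0\<close>,
    which is the value of \<open>f\<close> at all points of \<open>L \<inter> W\<close>.\<close>
  define V where "V = {\<omega> \<in> topspace ?C. \<omega> f \<in> ball 1 1}"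
  have "continuous_map ?C euclidean (\<lambda>\<omega>. \<omega> f)"
    unfolding higson_compactification_def
    by (intro continuous_map_from_subtopology continuous_map_product_projection f)
  then have "openin ?C V" unfolding V_def by (rule openin_continuous_map_preimage) simp
  moreover have "e \<in> V"
    using e lim[OF f f_lim] by (simp add: V_def topspace_higson_compactification)
  moreover have "V \<subseteq> topspace ?C" by (auto simp: V_def)
  ultimately have sub: "topspace X \<subseteq> X closure_of {x \<in> L. higson_embedding T d x \<in> V}"
    unfolding dense[symmetric] higson_limit_set_def Let_def by blast
  obtain q where "q \<in> W" using W(2) by blast
  moreover from this have "q \<in> X closure_of {x \<in> L. higson_embedding T d x \<in> V}"
    using sub openin_subset[OF W(1)] by blast
  ultimately obtain z where z: "z \<in> L" "higson_embedding T d z \<in> V" "z \<in> W"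
    using W(1) unfolding in_closure_of by blast
  have "f z \<in> ball 1 1" using z(2) f by (simp add: V_def higson_embedding_def)
  moreover have "f z = 0" using F_W[OF z(1,3)] z(1) by (simp add: f_def topspace_T)
  ultimately show False by simp
qed

end

theorem theorem1p15:
  fixes X :: "'a topology"
    and \<A> \<U> :: "('a, 'n::finite, 'z) chart set"
    and L :: "'a set"
  assumes "compact_polish_foliated_space X \<A>"
    and "regular_foliated_atlas X \<A> \<U>"
    and "L \<in> leaves X \<A>"
    and "\<not> compact_space (leaf_space X \<A> L)"
  shows "higson_recurrent X \<A> \<U> L \<longleftrightarrow> minimal_foliation X \<A>"
proof -
  interpret regular_leaf X \<A> \<U> L
    using assms by unfold_locales (auto simp: compact_polish_foliated_space_def)
  show ?thesis using minimal_imp_recurrent recurrent_imp_minimal assms(4) by blast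
qed

end
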